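(* Let $h\geq 3$ and let $G$ be a VPT graph. Then $G$ is a minimal non $[h,2,1]$ graph if and only if there exists an $(h+1)$-critical graph $H$ such that $G\simeq G_H$.
   Context: All graphs are finite, simple and connected. A VPT representation of $G$ is a tree $T$ with paths $(P_v)_{v\in V(G)}$ of $T$ such that $uv\in E(G)$ iff $P_u,P_v$ share a vertex; $G$ is VPT if it has one. $[h,2,1]$ is the class of graphs admitting a VPT representation whose host tree has maximum degree at most $h$. A minimal non $[h,2,1]$ graph is a graph $G\notin[h,2,1]$ with $G-v\in[h,2,1]$ for all $v\in V(G)$. A graph with chromatic number $k$ is $k$-critical if deleting any vertex or any edge lowers the chromatic number. Given a graph $H$ with $V(H)=\{v_1,\dots,v_n\}$, $G_H$ is the graph with vertex set: $v_i$ for $1\le i\le n$; $v_{ij}$ for $1\le i<j\le n$ with $v_iv_j\in E(H)$; $\tilde v_i$ for each $i$ with $d_H(v_i)=1$. Edges: all vertices $v_{ij}$ and $\tilde v_i$ are pairwise adjacent; $v_1,\dots,v_n$ are pairwise non-adjacent; $v_i$ is adjacent exactly to the vertices $v_{ij}$/$v_{ji}$ corresponding to edges of $H$ at $v_i$, and to $\tilde v_i$ if $d_H(v_i)=1$. *)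

theory Defs
  imports "Graph_Theory.Graph_Theory"
begin

(* Simple graphs are the symmetric, loop-free digraphs without parallel arcs of the locale
   "graph": every edge uv is a pair of opposite arcs, so the degree of a vertex is its out-degree. *)

(* The library predicate "tree" forbids all directed cycles, in particular u, v, u, and so fails
   for every symmetric digraph with an edge.  Here cycles have at least three arcs. *)
definition undirected_tree :: "('a, 'b) pre_digraph \<Rightarrow> bool" where
  "undirected_tree T \<longleftrightarrow>
     graph T \<and> connected T \<and> \<not> (\<exists>p. pre_digraph.cycle T p \<and> 3 \<le> length p)"

(* A path is given by its nonempty list of distinct vertices; one-vertex paths are allowed. *)
definition VPT_representation ::
  "('a, 'b) pre_digraph \<Rightarrow> ('c, 'd) pre_digraph \<Rightarrow> ('a \<Rightarrow> 'c list) \<Rightarrow> bool" where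
  "VPT_representation G T P \<longleftrightarrow>
     undirected_tree T \<and>
     (\<forall>v \<in> verts G. vpath (P v) T) \<and>
     (\<forall>u \<in> verts G. \<forall>v \<in> verts G. u \<noteq> v \<longrightarrow>
        (u \<rightarrow>\<^bsub>G\<^esub> v \<longleftrightarrow> set (P u) \<inter> set (P v) \<noteq> {}))"

(* Host trees are finite, so vertices of type nat suffice up to isomorphism. *)
definition VPT :: "('a, 'b) pre_digraph \<Rightarrow> bool" where
  "VPT G \<longleftrightarrow> (\<exists>(T :: nat pair_pre_digraph) P. VPT_representation G T P)"

(* The class [h,2,1].  Connectedness is not part of membership, so that G - v may be disconnected. *)
definition in_h21 :: "nat \<Rightarrow> ('a, 'b) pre_digraph \<Rightarrow> bool" where
  "in_h21 h G \<longleftrightarrow>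
     (\<exists>(T :: nat pair_pre_digraph) P. VPT_representation G T P \<and>
        (\<forall>x \<in> verts T. out_degree T x \<le> h))"

definition minimal_non_h21 :: "nat \<Rightarrow> ('a, 'b) pre_digraph \<Rightarrow> bool" where
  "minimal_non_h21 h G \<longleftrightarrow>
     \<not> in_h21 h G \<and> (\<forall>v \<in> verts G. in_h21 h (pre_digraph.del_vert G v))"

definition proper_colouring :: "('a, 'b) pre_digraph \<Rightarrow> nat \<Rightarrow> ('a \<Rightarrow> nat) \<Rightarrow> bool" where
  "proper_colouring G k c \<longleftrightarrow>
     (\<forall>v \<in> verts G. c v < k) \<and> (\<forall>u v. u \<rightarrow>\<^bsub>G\<^esub> v \<longrightarrow> c u \<noteq> c v)"

definition chromatic_number :: "('a, 'b) pre_digraph \<Rightarrow> nat" where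
  "chromatic_number G = (LEAST k. \<exists>c. proper_colouring G k c)"

(* Removes both arcs between u and v. *)
definition del_edge :: "('a, 'b) pre_digraph \<Rightarrow> 'a \<Rightarrow> 'a \<Rightarrow> ('a, 'b) pre_digraph" where
  "del_edge G u v =
     G\<lparr>arcs := {a \<in> arcs G. arc_to_ends G a \<noteq> (u, v) \<and> arc_to_ends G a \<noteq> (v, u)}\<rparr>"

definition critical :: "nat \<Rightarrow> ('a, 'b) pre_digraph \<Rightarrow> bool" where
  "critical k H \<longleftrightarrow>
     chromatic_number H = k \<and>
     (\<forall>v \<in> verts H. chromatic_number (pre_digraph.del_vert H v) < k) \<and>
     (\<forall>u v. u \<rightarrow>\<^bsub>H\<^esub> v \<longrightarrow> chromatic_number (del_edge H u v) < k)"

(* Original v_i stands for v_i, Edge {v_i, v_j} for v_ij (i < j), Pendant v_i for v_i tilde. *)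
datatype 'a gvertex = Original 'a | Edge "'a set" | Pendant 'a

definition edge_vertices :: "('a, 'b) pre_digraph \<Rightarrow> 'a gvertex set" where
  "edge_vertices H = {Edge {u, v} | u v. u \<rightarrow>\<^bsub>H\<^esub> v}"

definition pendant_vertices :: "('a, 'b) pre_digraph \<Rightarrow> 'a gvertex set" where
  "pendant_vertices H = {Pendant v | v. v \<in> verts H \<and> out_degree H v = 1}"

definition incidences :: "('a, 'b) pre_digraph \<Rightarrow> 'a gvertex rel" where
  "incidences H =
     {(Original u, Edge {u, v}) | u v. u \<rightarrow>\<^bsub>H\<^esub> v} \<union>
     {(Original v, Pendant v) | v. v \<in> verts H \<and> out_degree H v = 1}"

(* The graph G_H. *)
definition G_of :: "('a, 'b) pre_digraph \<Rightarrow> 'a gvertex pair_pre_digraph" where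
  "G_of H =
     (let K = edge_vertices H \<union> pendant_vertices H in
      \<lparr> pverts = Original ` verts H \<union> K,
        parcs = {(x, y). x \<in> K \<and> y \<in> K \<and> x \<noteq> y} \<union> incidences H \<union> (incidences H)\<inverse> \<rparr>)"

end

theory Submission
  imports Defs
begin

text \<open>Call two neighbours of a node \<open>q\<close> of the host tree adjacent if some path of the representation
  uses both, and call this the branch graph at \<open>q\<close>.  If two non-adjacent neighbours of \<open>q\<close> are
  detached and hung on a new node joined to \<open>q\<close>, the same graph is represented and the degree of
  \<open>q\<close> drops by one while the new node has degree 3.  Hence a representation all of whose branch
  graphs are \<open>h\<close>-colourable can be turned into one of maximum degree \<open>h\<close>.

  In a representation with fewest nodes, for adjacent nodes \<open>q\<close> and \<open>a\<close> some path contains \<open>a\<close> but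
  not \<open>q\<close> (otherwise contract the edge).  If the graph is not in \<open>[h,2,1]\<close>, take a node \<open>q\<close> whose
  branch graph is not \<open>h\<close>-colourable and an \<open>(h+1)\<close>-critical subgraph \<open>H\<close> of it: for each vertex
  \<open>a\<close> of \<open>H\<close> a path through \<open>a\<close> avoiding \<open>q\<close>, and for each edge \<open>ab\<close> a path through \<open>a\<close>, \<open>q\<close>, \<open>b\<close>,
  form an induced copy of \<open>G\<^sub>H\<close>.  Conversely \<open>G\<^sub>H\<close> is not in \<open>[h,2,1]\<close> by the Helly property, and
  deleting one of its vertices leaves a split graph represented on an \<open>h\<close>-colourable star.\<close>

section \<open>Rooted trees\<close>

text \<open>Merging arbitrary non-adjacent branches could make a branch graph need more than
  \<open>h\<close> colours. So colourings of all branch graphs are carried along and only two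
  branches of equal colour are merged: at the old node the new branch inherits that colour, and the
  new node has three branches, which \<open>h \<ge> 3\<close> colours can separate. In the converse
  the paths of original vertices need not touch or even approach the common node \<open>q\<close>,
  and several of them may share a branch. What has to be excluded is that adjacent vertices of
  \<open>H\<close> share one. Their topmost nodes would then lie on one descending path, and every
  edge path at the lower vertex would meet the path of the upper one. Vertices of an
  \<open>(h+1)\<close>-critical graph have degree at least \<open>h\<close>, so some edge at the
  lower vertex avoids the upper one; the same bound rules out pendant vertices. Branches are only
  studied at the root of a rooted tree, and the tree is rerooted at whichever node is of
  interest.\<close>

locale rooted_tree =
  fixes V :: "'c set" and E :: "'c rel" and r :: 'c and par :: "'c \<Rightarrow> 'c" and rk :: "'c \<Rightarrow> nat"
  assumes finite_V: "finite V"
    and root: "r \<in> V"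
    and par_in: "\<And>x. x \<in> V \<Longrightarrow> x \<noteq> r \<Longrightarrow> par x \<in> V"
    and rk_par: "\<And>x. x \<in> V \<Longrightarrow> x \<noteq> r \<Longrightarrow> rk (par x) < rk x"
    and E_eq: "E = {(x, y). x \<in> V \<and> x \<noteq> r \<and> y = par x \<or> y \<in> V \<and> y \<noteq> r \<and> x = par y}"
begin

lemma E_iff: "(x, y) \<in> E \<longleftrightarrow> x \<in> V \<and> x \<noteq> r \<and> y = par x \<or> y \<in> V \<and> y \<noteq> r \<and> x = par y"
  using E_eq by auto

lemma E_in: "(x, y) \<in> E \<Longrightarrow> x \<in> V \<and> y \<in> V"
  using E_iff par_in root by auto

lemma E_sym: "(x, y) \<in> E \<Longrightarrow> (y, x) \<in> E"
  using E_iff by auto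

lemma E_neq: "(x, y) \<in> E \<Longrightarrow> x \<noteq> y"
  using E_iff rk_par by (metis less_irrefl)

lemma E_root: "(r, a) \<in> E \<longleftrightarrow> a \<in> V \<and> a \<noteq> r \<and> par a = r"
  using E_iff by auto

lemma finite_E: "finite E"
  by (rule finite_subset[of _ "V \<times> V"]) (use E_in finite_V in auto)

lemma graph: "graph (with_proj \<lparr>pverts = V, parcs = E\<rparr>)"
proof -
  have "pair_graph \<lparr>pverts = V, parcs = E\<rparr>"
    by unfold_locales (use E_in E_neq finite_V finite_E E_sym in \<open>auto simp: symmetric_def sym_def\<close>)
  then interpret pair_graph "\<lparr>pverts = V, parcs = E\<rparr>" .
  show ?thesis by unfold_locales
qed

lemma reaches_root: "x \<in> V \<Longrightarrow> (x, r) \<in> E\<^sup>*"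
proof (induction "rk x" arbitrary: x rule: less_induct)
  case less
  show ?case
  proof (cases "x = r")
    case False
    then have "(par x, r) \<in> E\<^sup>*" "(x, par x) \<in> E"
      using less par_in rk_par E_iff by auto
    then show ?thesis by auto
  qed auto
qed

end

lemma strongly_connected_connected:
  assumes "graph G" "strongly_connected G"
  shows "connected G"
proof -
  interpret graph G by fact
  have "(arcs_ends G)\<^sup>s = arcs_ends G"
    using sym_arcs by (auto simp: symcl_def symmetric_def sym_def)
  then show ?thesis
    using assms(2) by (simp add: connected_conv strongly_connected_def reachable_def)
qed

lemma pcas_nth_Suc:
  "pcas u p v \<Longrightarrow> Suc i < length p \<Longrightarrow> fst (p ! Suc i) = snd (p ! i)"
proof (induction p arbitrary: u i)
  case (Cons e p)
  then show ?case by (cases i; cases p) auto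
qed simp

lemma pcas_ends: "pcas u p v \<Longrightarrow> p \<noteq> [] \<Longrightarrow> fst (hd p) = u \<and> snd (last p) = v"
proof (induction p arbitrary: u)
  case (Cons e p)
  then show ?case by (cases "p = []") auto
qed simp

lemma pawalk_verts_eq: "pcas u p v \<Longrightarrow> pawalk_verts u p = u # map snd p"
  by (induction p arbitrary: u) auto

text \<open>On a cycle take a node \<open>x\<close> of maximal rank. An edge to a node of no larger
  rank leads to the parent, so both cyclic neighbours of \<open>x\<close> equal
  \<open>par x\<close>. With at least three arcs they are heads of two different arcs, against
  distinctness.\<close>

lemma (in rooted_tree) undirected_tree: "undirected_tree (with_proj \<lparr>pverts = V, parcs = E\<rparr>)"
proof -
  let ?T = "\<lparr>pverts = V, parcs = E\<rparr>"
  interpret T: graph "with_proj ?T" by (rule graph)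
  have "strongly_connected (with_proj ?T)"
  proof
    show "verts (with_proj ?T) \<noteq> {}" using root by auto
    fix u v assume "u \<in> verts (with_proj ?T)" "v \<in> verts (with_proj ?T)"
    then have "u \<rightarrow>\<^sup>*\<^bsub>with_proj ?T\<^esub> r" "v \<rightarrow>\<^sup>*\<^bsub>with_proj ?T\<^esub> r"
      using reaches_root root by (simp_all add: T.reachable_conv)
    then show "u \<rightarrow>\<^sup>*\<^bsub>with_proj ?T\<^esub> v"
      using T.symmetric_reachable' T.reachable_trans by blast
  qed
  then have conn: "connected (with_proj ?T)"
    by (intro strongly_connected_connected graph)
  have "\<not> (pre_digraph.cycle (with_proj ?T) p \<and> 3 \<le> length p)" for p
  proof
    assume "pre_digraph.cycle (with_proj ?T) p \<and> 3 \<le> length p"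
    then obtain u where w: "T.awalk u p u" and d: "distinct (tl (T.awalk_verts u p))"
      and len: "3 \<le> length p"
      by (auto simp: T.cycle_def)
    define n where "n = length p"
    have sub: "set p \<subseteq> E" and cas: "pcas u p u"
      using w by (auto simp: T.awalk_def cas_with_proj_eq)
    have dist: "distinct (map snd p)"
      using d pawalk_verts_eq[OF cas] by (simp add: awalk_verts_with_proj_eq)
    have nz: "p \<noteq> []" using len by auto
    have step: "fst (p ! (Suc i mod n)) = snd (p ! i)" if "i < n" for i
    proof (cases "Suc i = n")
      case True
      then have "i = length p - 1" "Suc i mod n = 0" by (simp_all add: n_def)
      then show ?thesis
        using pcas_ends[OF cas nz] nz by (simp add: hd_conv_nth last_conv_nth)
    next
      case False
      then show ?thesis using that pcas_nth_Suc[OF cas] by (simp add: n_def)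
    qed
    let ?R = "(\<lambda>i. rk (snd (p ! i))) ` {..<n}"
    have R: "finite ?R" "?R \<noteq> {}" using nz by (auto simp: n_def)
    obtain i where i: "i < n" and "rk (snd (p ! i)) = Max ?R"
      using Max_in[OF R] by auto
    then have mx: "rk (snd (p ! j)) \<le> rk (snd (p ! i))" if "j < n" for j
      using Max_ge[OF R(1)] that by auto
    define x where "x = snd (p ! i)"
    have n3: "n \<ge> 3" using len n_def by simp
    \<comment> \<open>Arc \<open>i\<close> enters \<open>x\<close>, arc \<open>j\<close> follows it
      and arc \<open>k\<close> precedes it, so the neighbours of \<open>x\<close> on the cycle are
      the heads of the arcs \<open>j\<close> and \<open>k\<close>. Adding \<open>n - 1\<close>
      avoids truncated subtraction at \<open>i = 0\<close>.\<close>
    define j where "j = Suc i mod n"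
    define k where "k = (i + n - 1) mod n"
    have jn: "j < n" and kn: "k < n" using n3 by (auto simp: j_def k_def)
    have ki: "Suc k mod n = i"
      using i n3 by (simp add: k_def mod_Suc_eq)
    have jk: "j \<noteq> k"
    proof -
      have "j = (if Suc i = n then 0 else Suc i)" "k = (if i = 0 then n - 1 else i - 1)"
        using i n3 by (auto simp: j_def k_def mod_if)
      then show ?thesis using i n3 by (auto split: if_splits)
    qed
    have a: "p ! j = (x, snd (p ! j))" "p ! i = (snd (p ! k), x)"
      using step[OF i] step[OF kn] ki by (simp_all add: j_def x_def prod_eq_iff)
    have par: "y = par x" if "(x, y) \<in> E" "rk y \<le> rk x" for y
      using that E_iff[of x y] rk_par[of y] by auto
    have "p ! j \<in> E" "p ! i \<in> E"
      using sub jn i by (auto simp: n_def)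
    then have "(x, snd (p ! j)) \<in> E" "(x, snd (p ! k)) \<in> E"
      using a E_sym by metis+
    then have "snd (p ! j) = snd (p ! k)"
      using par mx[OF jn] mx[OF kn] x_def by metis
    then have "j = k"
      using dist jn kn by (simp add: n_def distinct_conv_nth) metis
    then show False using jk by simp
  qed
  then show ?thesis
    using conn graph by (auto simp: undirected_tree_def)
qed

text \<open>\<open>rk\<close> is the distance from \<open>r\<close>, and \<open>par\<close> picks a
  neighbour at smaller distance. The parent arcs already connect all nodes, so a further arc
  \<open>xy\<close> would close the path of parent arcs from \<open>x\<close> to \<open>y\<close>,
  which has at least two arcs, into a forbidden cycle.\<close>

lemma undirected_tree_rooted:
  fixes T :: "'c pair_pre_digraph"
  assumes "undirected_tree (with_proj T)" "r \<in> pverts T"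
  shows "\<exists>par rk. rooted_tree (pverts T) (parcs T) r par rk"
proof -
  let ?V = "pverts T" and ?E = "parcs T"
  interpret T: graph "with_proj T" using assms by (simp add: undirected_tree_def)
  have conn: "connected (with_proj T)" and acyc: "\<And>p. T.cycle p \<Longrightarrow> length p < 3"
    using assms by (auto simp: undirected_tree_def not_le)
  have E_in: "x \<in> ?V \<and> y \<in> ?V" if "(x, y) \<in> ?E" for x y
    using T.adj_in_verts[of x y] that by simp
  have E_sym: "(y, x) \<in> ?E" if "(x, y) \<in> ?E" for x y
    using T.graph_symmetric[of x y] that by simp
  have reach: "(r, x) \<in> ?E\<^sup>*" if "x \<in> ?V" for x
  proof -
    have "strongly_connected (with_proj T)"
      using T.symmetric_connected_imp_strongly_connected conn T.sym_arcs by blast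
    then have "r \<rightarrow>\<^sup>*\<^bsub>with_proj T\<^esub> x" using that assms by auto
    then show ?thesis by (simp add: T.reachable_conv)
  qed
  define rk where "rk x = (LEAST n. (r, x) \<in> ?E ^^ n)" for x
  have rk: "(r, x) \<in> ?E ^^ rk x" if "x \<in> ?V" for x
    unfolding rk_def using reach[OF that] by (metis LeastI rtrancl_power)
  have ex: "\<exists>y. (x, y) \<in> ?E \<and> rk y < rk x" if x: "x \<in> ?V" "x \<noteq> r" for x
  proof -
    have "rk x \<noteq> 0"
    proof
      assume "rk x = 0"
      then have "(r, x) \<in> ?E ^^ 0" using rk[OF x(1)] by metis
      then show False using x(2) by simp
    qed
    then obtain n where n: "rk x = Suc n" by (cases "rk x") auto
    then obtain y where y: "(r, y) \<in> ?E ^^ n" "(y, x) \<in> ?E"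
      using rk[OF x(1)] unfolding n relpow.simps(2) by (elim relcompE) auto
    have "rk y \<le> n" using y(1) by (simp add: rk_def Least_le)
    then show ?thesis using y(2) n E_sym by (intro exI[of _ y]) auto
  qed
  define par where "par x = (SOME y. (x, y) \<in> ?E \<and> rk y < rk x)" for x
  have par: "(x, par x) \<in> ?E" "rk (par x) < rk x" if "x \<in> ?V" "x \<noteq> r" for x
    using someI_ex[OF ex[OF that]] by (simp_all add: par_def)
  define E' where
    "E' = {(x, y). x \<in> ?V \<and> x \<noteq> r \<and> y = par x \<or> y \<in> ?V \<and> y \<noteq> r \<and> x = par y}"
  have E'_sub: "E' \<subseteq> ?E"
    using par E_sym by (auto simp: E'_def)
  interpret R: rooted_tree ?V E' r par rk
    using par E_in assms(2) T.finite_verts by unfold_locales (auto simp: E'_def)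
  let ?T' = "with_proj \<lparr>pverts = ?V, parcs = E'\<rparr>"
  interpret T': graph ?T' by (rule R.graph)
  have "?E \<subseteq> E'"
  proof (rule ccontr)
    assume "\<not> ?E \<subseteq> E'"
    then obtain x y where xy: "(x, y) \<in> ?E" "(x, y) \<notin> E'" by auto
    have "x \<rightarrow>\<^sup>*\<^bsub>?T'\<^esub> r" "y \<rightarrow>\<^sup>*\<^bsub>?T'\<^esub> r"
      using R.reaches_root R.root E_in[OF xy(1)] by (simp_all add: T'.reachable_conv)
    then have "x \<rightarrow>\<^sup>*\<^bsub>?T'\<^esub> y"
      using T'.symmetric_reachable' T'.reachable_trans by blast
    then obtain p where p: "T'.apath x p y"
      using T'.reachable_apath by blast
    have sub: "set p \<subseteq> E'" and cas: "pcas x p y"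
      using p by (auto simp: T'.apath_def T'.awalk_def cas_with_proj_eq)
    have dist: "distinct (x # map snd p)"
      using p pawalk_verts_eq[OF cas] by (simp add: T'.apath_def awalk_verts_with_proj_eq)
    have "x \<noteq> y" using T.adj_not_same[of x] xy(1) by auto
    then have p0: "p \<noteq> []" using cas by auto
    have p1: "length p \<noteq> 1"
    proof
      assume "length p = 1"
      then obtain e where "p = [e]" by (metis One_nat_def length_0_conv length_Suc_conv)
      then show False using cas sub xy(2) by (cases e) auto
    qed
    have cas': "pcas u q y \<Longrightarrow> pcas u (q @ [(y, x)]) x" for u q
      by (induction q arbitrary: u) auto
    have "T.cycle (p @ [(y, x)])"
      unfolding T.cycle_def T.awalk_def
      using cas'[OF cas] pawalk_verts_eq[OF cas'[OF cas]] sub E'_sub E_sym xy(1) E_in[OF xy(1)] dist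
      by (intro exI[of _ x]) (auto simp: cas_with_proj_eq awalk_verts_with_proj_eq)
    then have "length (p @ [(y, x)]) < 3" by (rule acyc)
    then show False using p0 p1 by (cases p; cases "tl p") auto
  qed
  then have "?E = E'" using E'_sub by auto
  then show ?thesis using R.rooted_tree_axioms by auto
qed

section \<open>Paths in rooted trees\<close>

definition tpath :: "'c rel \<Rightarrow> 'c list \<Rightarrow> bool" where
  "tpath E p \<longleftrightarrow> p \<noteq> [] \<and> distinct p \<and> successively (\<lambda>x y. (x, y) \<in> E) p"

lemma vpath_iff_tpath:
  "vpath p (with_proj T) \<longleftrightarrow> set p \<subseteq> pverts T \<and> tpath (parcs T) p"
proof -
  have "set (vwalk_arcs p) \<subseteq> parcs T \<longleftrightarrow> successively (\<lambda>x y. (x, y) \<in> parcs T) p"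
    by (induction p rule: vwalk_arcs.induct) auto
  then show ?thesis
    by (auto simp: vpath_def vwalk_def tpath_def)
qed

lemma tpath_rev: "sym E \<Longrightarrow> tpath E (rev p) \<longleftrightarrow> tpath E p"
  unfolding tpath_def by (auto simp: sym_conv_converse_eq elim!: successively_mono)

context rooted_tree
begin

lemma sym_E: "sym E"
  using E_sym by (auto simp: sym_def)

text \<open>The neighbour of the root on the way to \<open>x\<close>; it names the branch of \<open>x\<close> (junk for \<open>x = r\<close>).\<close>

definition top :: "'c \<Rightarrow> 'c" where
  "top x = (par ^^ ((LEAST n. (par ^^ n) x = r) - 1)) x"

lemma par_pow_root: "x \<in> V \<Longrightarrow> \<exists>n. (par ^^ n) x = r"
proof (induction "rk x" arbitrary: x rule: less_induct)
  case less
  show ?case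
  proof (cases "x = r")
    case True
    then show ?thesis by (auto intro: exI[of _ 0])
  next
    case False
    then obtain n where "(par ^^ n) (par x) = r"
      using less par_in rk_par by blast
    then have "(par ^^ Suc n) x = r" by (simp add: funpow_swap1)
    then show ?thesis by blast
  qed
qed

lemma top_child:
  assumes "x \<noteq> r" "par x = r"
  shows "top x = x"
proof -
  have "(LEAST n. (par ^^ n) x = r) = 1"
    using assms by (intro Least_equality) (auto simp: Suc_le_eq intro: gr0I)
  then show ?thesis by (simp add: top_def)
qed

lemma top_par:
  assumes "x \<in> V" "x \<noteq> r" "par x \<noteq> r"
  shows "top x = top (par x)"
proof -
  let ?d = "\<lambda>x. LEAST n. (par ^^ n) x = r"
  obtain n where "(par ^^ n) x = r" using par_pow_root assms(1) by blast
  then have d: "?d x = Suc (?d (par x))"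
    using Least_Suc[of "\<lambda>n. (par ^^ n) x = r" n] assms(2) by (simp add: funpow_swap1)
  obtain m where "(par ^^ m) (par x) = r" using par_pow_root par_in assms by blast
  then have "(par ^^ ?d (par x)) (par x) = r" by (rule LeastI)
  then have "?d (par x) \<noteq> 0" using assms(3) by (metis funpow_0)
  then obtain k where k: "?d (par x) = Suc k" by (cases "?d (par x)") auto
  show ?thesis unfolding top_def d k by (simp add: funpow_swap1)
qed

lemma top_nbr: "(r, a) \<in> E \<Longrightarrow> top a = a"
  using E_root top_child by auto

lemma top_edge: "(x, y) \<in> E \<Longrightarrow> x \<noteq> r \<Longrightarrow> y \<noteq> r \<Longrightarrow> top x = top y"
  using E_iff top_par by metis

lemma top_successively:
  "successively (\<lambda>x y. (x, y) \<in> E) p \<Longrightarrow> r \<notin> set p \<Longrightarrow> x \<in> set p \<Longrightarrow> top x = top (hd p)"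
proof (induction p)
  case (Cons z p)
  then show ?case
  proof (cases p)
    case (Cons y q)
    then show ?thesis
      using Cons.IH Cons.prems top_edge[of z y] by auto
  qed simp
qed simp

lemma path_avoiding_root:
  assumes "tpath E p" "r \<notin> set p" "x \<in> set p" "y \<in> set p"
  shows "top x = top y"
  using assms top_successively by (metis tpath_def)

lemma path_from_root:
  assumes "tpath E (r # p)"
  shows "p \<noteq> [] \<Longrightarrow> (r, hd p) \<in> E" "x \<in> set p \<Longrightarrow> top x = hd p"
proof -
  show "p \<noteq> [] \<Longrightarrow> (r, hd p) \<in> E"
    using assms by (cases p) (auto simp: tpath_def)
  then show "x \<in> set p \<Longrightarrow> top x = hd p"
    using top_successively[of p x] top_nbr[of "hd p"] assms
    by (cases p) (auto simp: tpath_def)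
qed

section \<open>Paths through the root and their two halves\<close>

lemma path_through_root:
  assumes "tpath E p" "r \<in> set p"
  obtains p1 p2 where "p = p1 @ r # p2" "tpath E (r # p2)" "tpath E (r # rev p1)"
    "set p1 \<inter> set p2 = {}"
proof -
  obtain p1 p2 where p: "p = p1 @ r # p2" using assms(2) split_list by metis
  have "tpath E (p1 @ [r])" "tpath E (r # p2)"
    using assms(1) unfolding p tpath_def by (auto simp: successively_append_iff)
  moreover have "tpath E (r # rev p1)"
    using tpath_rev[OF sym_E, of "p1 @ [r]"] calculation(1) by simp
  moreover have "set p1 \<inter> set p2 = {}"
    using assms(1) unfolding p tpath_def by auto
  ultimately show thesis using that p by blast
qed

text \<open>Each half of the path stays in the branch of its first node, so on the way to
  \<open>x\<close> it has passed the entrance \<open>top x\<close> of that branch. Thus meeting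
  something inside a branch forces the path to contain a neighbour of the root.\<close>

lemma gate:
  assumes "tpath E p" "r \<in> set p" "x \<in> set p" "x \<noteq> r"
  shows "top x \<in> set p"
proof -
  obtain p1 p2 where p: "p = p1 @ r # p2" and t: "tpath E (r # p2)" "tpath E (r # rev p1)"
    using path_through_root[OF assms(1,2)] by metis
  have "x \<in> set p2 \<or> x \<in> set (rev p1)" using assms p by auto
  then show ?thesis
  proof
    assume x: "x \<in> set p2"
    then have "top x = hd p2" by (rule path_from_root(2)[OF t(1)])
    then show ?thesis using x p by (cases p2) auto
  next
    assume x: "x \<in> set (rev p1)"
    then have "top x = hd (rev p1)" by (rule path_from_root(2)[OF t(2)])
    then have "top x \<in> set (rev p1)" using x by (metis hd_in_set empty_iff set_empty)
    then show ?thesis using p by simp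
  qed
qed

text \<open>Each of the two halves contains at most one neighbour of the root, namely its first
  node.\<close>

lemma path_root_nbrs:
  assumes "tpath E p" "r \<in> set p" "{a, b, c} \<subseteq> set p"
    and "(r, a) \<in> E" "(r, b) \<in> E" "(r, c) \<in> E"
  shows "a = b \<or> a = c \<or> b = c"
proof -
  obtain p1 p2 where p: "p = p1 @ r # p2" and t: "tpath E (r # p2)" "tpath E (r # rev p1)"
    using path_through_root[OF assms(1,2)] by metis
  have "x = hd p2 \<or> x = hd (rev p1)" if "x \<in> set p" "(r, x) \<in> E" for x
  proof -
    have "x \<in> set p2 \<or> x \<in> set (rev p1)" using that p E_neq by auto
    then show ?thesis
      using path_from_root(2)[OF t(1), of x] path_from_root(2)[OF t(2), of x] top_nbr[OF that(2)]
      by auto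
  qed
  then show ?thesis using assms by (metis insert_subset)
qed

text \<open>The node \<open>t\<close> is the topmost one. Prepending a neighbour \<open>x\<close> of
  the head \<open>y\<close> changes it only if \<open>y = t\<close> and \<open>x\<close> is the
  parent of \<open>y\<close>; otherwise \<open>x\<close> is a child of \<open>y\<close>, or
  \<open>x = par y\<close> already occurs.\<close>

lemma path_apex:
  "successively (\<lambda>x y. (x, y) \<in> E) p \<Longrightarrow> p \<noteq> [] \<Longrightarrow>
    \<exists>t \<in> set p. \<forall>z \<in> set p. z \<noteq> t \<longrightarrow> z \<in> V \<and> z \<noteq> r \<and> par z \<in> set p"
proof (induction p)
  case (Cons x p)
  show ?case
  proof (cases p)
    case Nil
    then show ?thesis by simp
  next
    case (Cons y q)
    then have xy: "(x, y) \<in> E" using Cons.prems by simp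
    obtain t where t: "t \<in> set p" "\<And>z. z \<in> set p \<Longrightarrow> z \<noteq> t \<Longrightarrow> z \<in> V \<and> z \<noteq> r \<and> par z \<in> set p"
      using Cons.IH Cons.prems Cons by auto
    have yp: "y \<in> set p" using Cons by simp
    show ?thesis
    proof (cases "x \<in> V \<and> x \<noteq> r \<and> y = par x \<or> y \<noteq> t")
      case True
      have "x \<in> V \<and> x \<noteq> r \<and> y = par x \<or> par y \<in> set p \<and> x = par y"
        using True t(2)[OF yp] xy E_iff by auto
      then show ?thesis
        by (intro bexI[of _ t]) (use t yp in auto)
    next
      case False
      then have "y \<in> V \<and> y \<noteq> r \<and> x = par y \<and> y = t" using xy E_iff by auto
      then show ?thesis
        by (intro bexI[of _ x]) (use t in auto)
    qed
  qed
qed simp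

text \<open>Sets closed under ancestors. They replace an explicit order: that every
  \<open>par_closed\<close> set containing \<open>s\<close> contains \<open>t\<close> says that
  \<open>t\<close> is an ancestor of \<open>s\<close>.\<close>

definition par_closed :: "'c set \<Rightarrow> bool" where
  "par_closed S \<longleftrightarrow> (\<forall>z \<in> S. z \<noteq> r \<longrightarrow> par z \<in> S)"

text \<open>The root can only be the topmost node of a path through it, so all other nodes have
  their parents on the path.\<close>

lemma path_par_closed:
  assumes "tpath E p" "r \<in> set p"
  shows "par_closed (set p)"
  using path_apex[of p] assms unfolding tpath_def par_closed_def by metis

text \<open>After a step from parent to child a path cannot turn back: the next node is a child or
  the parent, and the parent has just been visited.\<close>

lemma descending:
  "tpath E (x # p) \<Longrightarrow> (p \<noteq> [] \<Longrightarrow> hd p \<noteq> r \<and> par (hd p) = x) \<Longrightarrow>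
    successively (\<lambda>u v. v \<noteq> r \<and> par v = u) (x # p)"
proof (induction p arbitrary: x)
  case (Cons y p)
  have "p \<noteq> [] \<Longrightarrow> hd p \<noteq> r \<and> par (hd p) = y"
    using Cons.prems E_iff[of y "hd p"] by (cases p) (auto simp: tpath_def)
  then have "successively (\<lambda>u v. v \<noteq> r \<and> par v = u) (y # p)"
    using Cons by (intro Cons.IH) (auto simp: tpath_def)
  then show ?case using Cons.prems by auto
qed simp

lemma par_closed_descending:
  "successively (\<lambda>u v. v \<noteq> r \<and> par v = u) (x # p) \<Longrightarrow> par_closed S \<Longrightarrow> y \<in> set p \<Longrightarrow> y \<in> S \<Longrightarrow> x \<in> S"
proof (induction p arbitrary: x)
  case (Cons z p)
  then have "z \<in> S" by (cases "y = z") auto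
  then show ?case using Cons.prems by (auto simp: par_closed_def)
qed simp

lemma descending_comparable:
  "successively (\<lambda>u v. v \<noteq> r \<and> par v = u) p \<Longrightarrow> s \<in> set p \<Longrightarrow> t \<in> set p \<Longrightarrow>
    (\<forall>S. par_closed S \<longrightarrow> s \<in> S \<longrightarrow> t \<in> S) \<or> (\<forall>S. par_closed S \<longrightarrow> t \<in> S \<longrightarrow> s \<in> S)"
proof (induction p)
  case (Cons x p)
  show ?case
  proof (cases "s \<in> set p \<and> t \<in> set p")
    case True
    then show ?thesis using Cons by (cases p) auto
  next
    case False
    then show ?thesis using Cons.prems par_closed_descending[OF Cons.prems(1)] by auto
  qed
qed simp

text \<open>The two halves of the path are disjoint and so lie in different branches. Two nodes of
  one branch therefore lie on the same half, which descends, and one is an ancestor of the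
  other.\<close>

lemma same_branch_comparable:
  assumes "tpath E p" "r \<in> set p" "s \<in> set p" "t \<in> set p" "s \<noteq> r" "t \<noteq> r" "top s = top t"
  shows "(\<forall>S. par_closed S \<longrightarrow> s \<in> S \<longrightarrow> t \<in> S) \<or> (\<forall>S. par_closed S \<longrightarrow> t \<in> S \<longrightarrow> s \<in> S)"
proof -
  obtain p1 p2 where p: "p = p1 @ r # p2" and t: "tpath E (r # p2)" "tpath E (r # rev p1)"
    and disj: "set p1 \<inter> set p2 = {}"
    using path_through_root[OF assms(1,2)] by metis
  have *: ?thesis if "tpath E (r # q)" "s \<in> set q" "t \<in> set q" for q
  proof -
    have "successively (\<lambda>u v. v \<noteq> r \<and> par v = u) (r # q)"
      using descending[OF that(1)] path_from_root(1)[OF that(1)] E_root by auto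
    then show ?thesis by (rule descending_comparable) (use that in auto)
  qed
  have "hd p2 \<noteq> hd (rev p1)" if "p1 \<noteq> []" "p2 \<noteq> []"
    using disj that by (metis Int_iff empty_iff hd_in_set rev_is_Nil_conv set_rev)
  moreover have "s \<in> set p1 \<or> s \<in> set p2" "t \<in> set p1 \<or> t \<in> set p2"
    using assms p by auto
  ultimately have "s \<in> set p1 \<and> t \<in> set p1 \<or> s \<in> set p2 \<and> t \<in> set p2"
    using path_from_root(2)[OF t(1)] path_from_root(2)[OF t(2)] assms(7)
    by (metis empty_iff set_empty set_rev)
  then show ?thesis using *[OF t(1)] *[OF t(2)] by auto
qed

text \<open>Among the topmost nodes take one, \<open>t i\<close>, of largest rank. From a common
  node of \<open>P i\<close> and \<open>P j\<close> one climbs inside both paths until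
  \<open>t i\<close> is reached: before that the rank is larger than that of \<open>t j\<close> as
  well, so the parent is still on \<open>P j\<close>.\<close>

lemma helly:
  assumes "finite I" "I \<noteq> {}" and path: "\<And>i. i \<in> I \<Longrightarrow> tpath E (P i)"
    and meet: "\<And>i j. i \<in> I \<Longrightarrow> j \<in> I \<Longrightarrow> set (P i) \<inter> set (P j) \<noteq> {}"
  shows "\<exists>q. \<forall>i \<in> I. q \<in> set (P i)"
proof -
  have "\<exists>t. \<forall>i \<in> I. t i \<in> set (P i) \<and>
      (\<forall>z \<in> set (P i). z \<noteq> t i \<longrightarrow> z \<in> V \<and> z \<noteq> r \<and> par z \<in> set (P i))"
    using path_apex path unfolding tpath_def by (intro bchoice) blast
  then obtain t where t: "\<And>i. i \<in> I \<Longrightarrow> t i \<in> set (P i)"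
    "\<And>i z. i \<in> I \<Longrightarrow> z \<in> set (P i) \<Longrightarrow> z \<noteq> t i \<Longrightarrow> z \<in> V \<and> z \<noteq> r \<and> par z \<in> set (P i)"
    by blast
  have top_min: "rk (t i) \<le> rk z" if "i \<in> I" "z \<in> set (P i)" for i z
    using that
  proof (induction "rk z" arbitrary: z rule: less_induct)
    case less
    show ?case
    proof (cases "z = t i")
      case False
      then have "z \<in> V" "z \<noteq> r" "par z \<in> set (P i)" using t(2) less.prems by auto
      then show ?thesis using less rk_par[of z] by fastforce
    qed simp
  qed
  let ?R = "(\<lambda>i. rk (t i)) ` I"
  have R: "finite ?R" "?R \<noteq> {}" using assms by auto
  obtain i where i: "i \<in> I" and "rk (t i) = Max ?R"
    using Max_in[OF R] by auto
  then have mx: "rk (t j) \<le> rk (t i)" if "j \<in> I" for j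
    using Max_ge[OF R(1)] that by auto
  have "t i \<in> set (P j)" if j: "j \<in> I" and "z \<in> set (P i)" "z \<in> set (P j)" for j z
    using that(2,3)
  proof (induction "rk z" arbitrary: z rule: less_induct)
    case less
    show ?case
    proof (cases "z = t i")
      case False
      then have z: "z \<in> V" "z \<noteq> r" "par z \<in> set (P i)" using t(2)[OF i] less.prems by auto
      then have "rk (t i) < rk z"
        using rk_par[of z] top_min[OF i z(3)] by simp
      then have "z \<noteq> t j" using mx[OF j] by auto
      then have "par z \<in> set (P j)" using t(2)[OF j] less.prems by auto
      then show ?thesis using less.hyps rk_par z by blast
    qed (use less in auto)
  qed
  then have "\<forall>j \<in> I. t i \<in> set (P j)" using meet[OF i] by blast
  then show ?thesis by blast
qed

end

section \<open>Reducing degrees\<close>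

definition tree_on :: "'c set \<Rightarrow> 'c rel \<Rightarrow> bool" where
  "tree_on V E \<longleftrightarrow> (\<exists>r par rk. rooted_tree V E r par rk)"

lemma tree_on_iff_undirected_tree:
  "undirected_tree (with_proj T) \<longleftrightarrow> tree_on (pverts T) (parcs T)"
proof
  assume T: "undirected_tree (with_proj T)"
  then have "pverts T \<noteq> {}"
    by (auto simp: undirected_tree_def connected_conv)
  then show "tree_on (pverts T) (parcs T)"
    using undirected_tree_rooted[OF T] by (auto simp: tree_on_def)
next
  assume "tree_on (pverts T) (parcs T)"
  then obtain r par rk where "rooted_tree (pverts T) (parcs T) r par rk"
    by (auto simp: tree_on_def)
  then show "undirected_tree (with_proj T)"
    using rooted_tree.undirected_tree by (cases T) fastforce
qed

text \<open>Passing through \<open>undirected_tree\<close> forgets the old root; distances from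
  \<open>q\<close> then supply new parents and ranks.\<close>

lemma tree_on_reroot:
  assumes "tree_on V E" "q \<in> V"
  shows "\<exists>par rk. rooted_tree V E q par rk"
  using undirected_tree_rooted[of "\<lparr>pverts = V, parcs = E\<rparr>" q] assms
  by (simp add: tree_on_iff_undirected_tree)

definition path_family :: "'c set \<Rightarrow> 'c rel \<Rightarrow> 'i set \<Rightarrow> ('i \<Rightarrow> 'c list) \<Rightarrow> bool" where
  "path_family V E I P \<longleftrightarrow> tree_on V E \<and> (\<forall>i \<in> I. set (P i) \<subseteq> V \<and> tpath E (P i))"

definition same_meets :: "'i set \<Rightarrow> ('i \<Rightarrow> 'c list) \<Rightarrow> ('i \<Rightarrow> 'd list) \<Rightarrow> bool" where
  "same_meets I P Q \<longleftrightarrow>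
     (\<forall>i \<in> I. \<forall>j \<in> I. set (P i) \<inter> set (P j) = {} \<longleftrightarrow> set (Q i) \<inter> set (Q j) = {})"

text \<open>\<open>c x y\<close> is the colour, at the node \<open>x\<close>, of the branch through its neighbour \<open>y\<close>.\<close>

definition branch_colouring ::
  "nat \<Rightarrow> 'c rel \<Rightarrow> 'i set \<Rightarrow> ('i \<Rightarrow> 'c list) \<Rightarrow> ('c \<Rightarrow> 'c \<Rightarrow> nat) \<Rightarrow> bool" where
  "branch_colouring h E I P c \<longleftrightarrow>
     (\<forall>x y. (x, y) \<in> E \<longrightarrow> c x y < h) \<and>
     (\<forall>i \<in> I. \<forall>x \<in> set (P i). \<forall>y \<in> set (P i). \<forall>z \<in> set (P i).
        (x, y) \<in> E \<longrightarrow> (x, z) \<in> E \<longrightarrow> c x y = c x z \<longrightarrow> y = z)"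

lemma tpath_join:
  assumes "sym E" "tpath E (r # p)" "tpath E (r # q)" "set p \<inter> set q = {}"
  shows "tpath E (rev p @ r # q)"
proof -
  have "tpath E (rev p @ [r])" using tpath_rev[OF assms(1), of "r # p"] assms(2) by simp
  then show ?thesis
    using assms(3,4) unfolding tpath_def by (auto simp: successively_append_iff)
qed

section \<open>Merging two branches at a node\<close>

definition merge :: "'c rel \<Rightarrow> 'c \<Rightarrow> 'c \<Rightarrow> 'c \<Rightarrow> 'c \<Rightarrow> 'c rel" where
  "merge E q a b s =
     (E - {(q, a), (a, q), (q, b), (b, q)}) \<union> {(q, s), (s, q), (s, a), (a, s), (s, b), (b, s)}"

context rooted_tree
begin

lemma finite_nbrs: "finite (E `` {x})"
  by (rule finite_subset[OF _ finite_V]) (use E_in in blast)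

text \<open>The old ranks are raised by 2 and \<open>r\<close> gets 0, which leaves rank 1 for
  \<open>s\<close>, between \<open>r\<close> and its new grandchildren \<open>a\<close> and
  \<open>b\<close>.\<close>

lemma merge_rooted_tree:
  assumes ab: "(r, a) \<in> E" "(r, b) \<in> E" and s: "s \<notin> V"
  shows "rooted_tree (insert s V) (merge E r a b s) r (par(a := s, b := s, s := r))
    (\<lambda>x. if x = r then 0 else if x = s then 1 else rk x + 2)"
proof -
  have ab': "a \<in> V" "b \<in> V" "a \<noteq> r" "b \<noteq> r" "par a = r" "par b = r"
    using ab E_root by auto
  have s': "s \<noteq> a" "s \<noteq> b" "s \<noteq> r" using s ab' root by auto
  have par_s: "par x \<noteq> s" if "x \<in> V" "x \<noteq> r" for x using s par_in that by auto
  let ?par = "par(a := s, b := s, s := r)"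
  show ?thesis
  proof
    define S where "S = {(r, a), (a, r), (r, b), (b, r)}"
    have S_sym: "(y, x) \<in> S \<longleftrightarrow> (x, y) \<in> S" for x y
      by (auto simp: S_def)
    \<comment> \<open>The parent arcs that disappear are exactly those of \<open>a\<close> and
      \<open>b\<close>; \<open>new\<close> shows that arcs to \<open>s\<close> replace them and that
      the arc from \<open>s\<close> to \<open>r\<close> is added.\<close>
    have old: "x \<in> V \<and> x \<noteq> r \<and> y = par x \<and> (x, y) \<notin> S \<longleftrightarrow>
        x \<in> V \<and> x \<noteq> r \<and> y = par x \<and> x \<notin> {a, b}" for x y
      using ab' by (simp add: S_def) metis
    have new: "x \<in> insert s V \<and> x \<noteq> r \<and> y = ?par x \<longleftrightarrow>
        (x \<in> V \<and> x \<noteq> r \<and> y = par x \<and> x \<notin> {a, b}) \<or> x \<in> {a, b} \<and> y = s \<or> x = s \<and> y = r" for x y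
    proof -
      consider "x = s" | "x \<in> {a, b}" | "x \<notin> {s, a, b}" by blast
      then show ?thesis
        by cases (use ab' s s' in auto)
    qed
    show "merge E r a b s =
      {(x, y). x \<in> insert s V \<and> x \<noteq> r \<and> y = ?par x \<or> y \<in> insert s V \<and> y \<noteq> r \<and> x = ?par y}"
    proof (rule set_eqI, clarify)
      fix x y
      have "(x, y) \<in> {(r, s), (s, r), (s, a), (a, s), (s, b), (b, s)} \<longleftrightarrow>
          (x \<in> {a, b} \<and> y = s \<or> x = s \<and> y = r) \<or> (y \<in> {a, b} \<and> x = s \<or> y = s \<and> x = r)"
        by simp argo
      then have "(x, y) \<in> merge E r a b s \<longleftrightarrow>
          (x \<in> V \<and> x \<noteq> r \<and> y = par x \<and> (x, y) \<notin> S \<or> x \<in> {a, b} \<and> y = s \<or> x = s \<and> y = r) \<or>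
          (y \<in> V \<and> y \<noteq> r \<and> x = par y \<and> (y, x) \<notin> S \<or> y \<in> {a, b} \<and> x = s \<or> y = s \<and> x = r)"
        unfolding merge_def Un_iff Diff_iff E_iff S_def[symmetric] S_sym[of y x] by argo
      then show "(x, y) \<in> merge E r a b s \<longleftrightarrow> (x, y) \<in>
        {(x, y). x \<in> insert s V \<and> x \<noteq> r \<and> y = ?par x \<or> y \<in> insert s V \<and> y \<noteq> r \<and> x = ?par y}"
        unfolding old mem_Collect_eq prod.case new by argo
    qed
    fix x assume x: "x \<in> insert s V" "x \<noteq> r"
    show "?par x \<in> insert s V" using x par_in root by auto
    show "(if ?par x = r then 0 else if ?par x = s then 1 else rk (?par x) + 2) <
      (if x = r then 0 else if x = s then 1 else rk x + 2)"
      using x par_s s' ab' rk_par by auto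
  qed (use finite_V root in auto)
qed

lemma merge_sym: "sym (merge E r a b s)"
  using sym_E by (auto simp: sym_def merge_def)

text \<open>Only a first step to \<open>a\<close> or \<open>b\<close> is affected; there
  \<open>s\<close> is inserted after \<open>r\<close>.\<close>

lemma merge_path_from_root:
  assumes "tpath E (r # p)" "set p \<subseteq> V" "s \<notin> V"
  shows "\<exists>p'. tpath (merge E r a b s) (r # p') \<and> set p \<subseteq> set p' \<and> set p' \<subseteq> insert s (set p) \<and>
    (s \<in> set p' \<longrightarrow> p \<noteq> [] \<and> hd p \<in> {a, b})"
proof (cases p)
  case Nil
  then show ?thesis by (intro exI[of _ "[]"]) (simp add: tpath_def)
next
  case (Cons y q)
  have rs: "r \<noteq> s" using assms root by auto
  have "successively (\<lambda>x y. (x, y) \<in> E) p" "r \<notin> set p"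
    using assms(1) by (auto simp: tpath_def Cons)
  then have "successively (\<lambda>x y. (x, y) \<in> merge E r a b s) p"
    by (elim successively_mono) (auto simp: merge_def)
  moreover have "(r, y) \<in> E" "r \<notin> set p" "distinct p" "s \<notin> set p"
    using assms by (auto simp: tpath_def Cons)
  ultimately have *: "tpath (merge E r a b s) (r # (if y \<in> {a, b} then s # p else p))"
    using rs by (simp add: tpath_def Cons) (auto simp: merge_def)
  show ?thesis
    by (rule exI, rule conjI[OF *]) (use \<open>s \<notin> set p\<close> Cons in \<open>auto split: if_splits\<close>)
qed

text \<open>The halves at \<open>r\<close> are rerouted separately and rejoined. This could fail
  only if both received \<open>s\<close>, that is, if the path used \<open>a\<close> on one side and
  \<open>b\<close> on the other, which \<open>not\<close> excludes. The last conclusion is what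
  later preserves intersections: paths that receive \<open>s\<close> share \<open>r\<close>
  already.\<close>

lemma merge_path:
  assumes p: "tpath E p" "set p \<subseteq> V" and not: "r \<in> set p \<Longrightarrow> a \<in> set p \<Longrightarrow> b \<in> set p \<Longrightarrow> a = b"
    and s: "s \<notin> V"
  obtains p' where "tpath (merge E r a b s) p'" "set p \<subseteq> set p'" "set p' \<subseteq> insert s (set p)"
    "s \<in> set p' \<Longrightarrow> r \<in> set p \<and> (a \<in> set p \<or> b \<in> set p)"
proof (cases "r \<in> set p")
  case False
  have "successively (\<lambda>x y. (x, y) \<in> E) p" using p by (simp add: tpath_def)
  then have "successively (\<lambda>x y. (x, y) \<in> merge E r a b s) p"
    by (rule successively_mono) (use False in \<open>auto simp: merge_def\<close>)
  then have "tpath (merge E r a b s) p"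
    using p by (simp add: tpath_def)
  then show thesis using that s p(2) by blast
next
  case True
  obtain p1 p2 where pp: "p = p1 @ r # p2" and t: "tpath E (r # p2)" "tpath E (r # rev p1)"
    and disj: "set p1 \<inter> set p2 = {}"
    using path_through_root[OF p(1) True] by metis
  obtain q2 where q2: "tpath (merge E r a b s) (r # q2)" "set p2 \<subseteq> set q2"
    "set q2 \<subseteq> insert s (set p2)" "s \<in> set q2 \<Longrightarrow> p2 \<noteq> [] \<and> hd p2 \<in> {a, b}"
    using merge_path_from_root[OF t(1) _ s, of a b] p(2) pp by auto
  obtain q1 where q1: "tpath (merge E r a b s) (r # q1)" "set p1 \<subseteq> set q1"
    "set q1 \<subseteq> insert s (set p1)" "s \<in> set q1 \<Longrightarrow> p1 \<noteq> [] \<and> hd (rev p1) \<in> {a, b}"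
    using merge_path_from_root[OF t(2) _ s, of a b] p(2) pp unfolding set_rev rev_is_Nil_conv by auto
  have hds: "p2 \<noteq> [] \<Longrightarrow> hd p2 \<in> set p2" "p1 \<noteq> [] \<Longrightarrow> hd (rev p1) \<in> set p1"
    using hd_in_set[of "rev p1"] by auto
  have "\<not> (s \<in> set q1 \<and> s \<in> set q2)"
  proof
    assume "s \<in> set q1 \<and> s \<in> set q2"
    then have *: "hd p2 \<in> {a, b} \<inter> set p2" "hd (rev p1) \<in> {a, b} \<inter> set p1"
      using q1(4) q2(4) hds by blast+
    then have ne: "hd p2 \<noteq> hd (rev p1)" using disj by (metis IntD2 disjoint_iff)
    have "hd p2 \<in> set p" "hd (rev p1) \<in> set p"
      using * pp by (metis IntD2 Un_iff set_append list.set_intros(2))+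
    moreover have "u \<in> {a, b} \<Longrightarrow> w \<in> {a, b} \<Longrightarrow> u \<noteq> w \<Longrightarrow> u \<in> set p \<Longrightarrow> w \<in> set p \<Longrightarrow>
        a \<in> set p \<and> b \<in> set p \<and> a \<noteq> b" for u w by blast
    ultimately have "a \<in> set p" "b \<in> set p" "a \<noteq> b" using * ne by (meson IntD1)+
    then show False using not True by blast
  qed
  then have "set q1 \<inter> set q2 = {}"
    using q1(3) q2(3) disj by auto
  then have "tpath (merge E r a b s) (rev q1 @ r # q2)"
    by (rule tpath_join[OF merge_sym q1(1) q2(1)])
  moreover have "a \<in> set p \<or> b \<in> set p" if "s \<in> set (rev q1 @ r # q2)"
  proof -
    have "s \<in> set q1 \<or> s \<in> set q2" using that s root by auto
    then have "hd p2 \<in> {a, b} \<inter> set p2 \<or> hd (rev p1) \<in> {a, b} \<inter> set p1"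
      using q1(4) q2(4) hds by blast
    moreover have "set p1 \<subseteq> set p" "set p2 \<subseteq> set p" using pp by auto
    ultimately show ?thesis by blast
  qed
  moreover have "set p \<subseteq> set (rev q1 @ r # q2)" "set (rev q1 @ r # q2) \<subseteq> insert s (set p)"
    using q1(2,3) q2(2,3) pp by auto
  ultimately show thesis using that True by blast
qed

lemma merge_nbrs:
  assumes ab: "(r, a) \<in> E" "(r, b) \<in> E" and s: "s \<notin> V"
  shows "merge E r a b s `` {s} = {r, a, b}"
    "merge E r a b s `` {r} = insert s (E `` {r} - {a, b})"
    "x \<in> {a, b} \<Longrightarrow> merge E r a b s `` {x} = insert s (E `` {x} - {r})"
    "x \<notin> {s, r, a, b} \<Longrightarrow> merge E r a b s `` {x} = E `` {x}"
proof -
  have *: "(s, x) \<notin> E" "(x, s) \<notin> E" for x using s E_in by auto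
  have **: "a \<noteq> r" "b \<noteq> r" "s \<noteq> r" "a \<noteq> s" "b \<noteq> s" using ab s E_in E_neq by blast+
  have m: "(x, y) \<in> merge E r a b s \<longleftrightarrow>
      (x, y) \<in> E \<and> (x, y) \<notin> {(r, a), (a, r), (r, b), (b, r)} \<or>
      (x, y) \<in> {(r, s), (s, r), (s, a), (a, s), (s, b), (b, s)}" for x y
    unfolding merge_def by blast
  show "merge E r a b s `` {s} = {r, a, b}"
    by (rule set_eqI) (use * in \<open>simp add: m\<close>, use ** in blast)
  show "merge E r a b s `` {r} = insert s (E `` {r} - {a, b})"
    by (rule set_eqI) (use ** in \<open>simp add: m\<close>, blast)
  show "merge E r a b s `` {x} = insert s (E `` {x} - {r})" if "x \<in> {a, b}"
    by (rule set_eqI) (use ** that in \<open>simp add: m\<close>, blast)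
  show "merge E r a b s `` {x} = E `` {x}" if "x \<notin> {s, r, a, b}"
    by (rule set_eqI) (use that in \<open>simp add: m\<close>)
qed

lemma merge_degrees:
  assumes ab: "(r, a) \<in> E" "(r, b) \<in> E" "a \<noteq> b" and s: "s \<notin> V"
  shows "card (merge E r a b s `` {s}) = 3"
    "Suc (card (merge E r a b s `` {r})) = card (E `` {r})"
    "x \<in> V \<Longrightarrow> x \<noteq> r \<Longrightarrow> card (merge E r a b s `` {x}) = card (E `` {x})"
proof -
  note fin = finite_nbrs
  have sE: "s \<notin> E `` {x}" for x using s E_in by blast
  have ne: "a \<noteq> r" "b \<noteq> r" using ab E_neq by blast+
  note nb = merge_nbrs[OF ab(1,2) s]
  show "card (merge E r a b s `` {s}) = 3" using nb(1) ne ab(3) by simp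
  have "card (E `` {r} - {a, b}) = card (E `` {r}) - 2" "2 \<le> card (E `` {r})"
    using card_Diff_subset[of "{a, b}" "E `` {r}"] card_mono[OF fin, of "{a, b}" r] ab by simp_all
  then show "Suc (card (merge E r a b s `` {r})) = card (E `` {r})"
    using nb(2) fin sE by simp
  show "card (merge E r a b s `` {x}) = card (E `` {x})" if "x \<in> V" "x \<noteq> r"
  proof (cases "x \<in> {a, b}")
    case True
    then have "r \<in> E `` {x}" using ab E_sym by blast
    then show ?thesis
      using nb(3)[OF True] card_Suc_Diff1[OF fin] sE fin by (metis DiffD1 card_insert_disjoint finite_Diff)
  next
    case False
    moreover have "x \<noteq> s" using that s by blast
    ultimately show ?thesis using that nb(4)[of x] by auto
  qed
qed

end

text \<open>Subtraction on \<open>nat\<close> truncates, so nodes of degree at most \<open>h\<close>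
  contribute nothing; in particular a new node of degree 3 costs nothing when
  \<open>h \<ge> 3\<close>.\<close>

abbreviation excess :: "nat \<Rightarrow> 'c set \<Rightarrow> 'c rel \<Rightarrow> nat" where
  "excess h V E \<equiv> \<Sum>x \<in> V. card (E `` {x}) - h"

lemma merge_step:
  assumes h: "h \<ge> 3" and "rooted_tree V E q par rk"
    and fam: "path_family V E I P" and col: "branch_colouring h E I P c"
    and big: "h < card (E `` {q})"
    and s: "s \<notin> V"
  obtains E' P' c' where "path_family (insert s V) E' I P'" "branch_colouring h E' I P' c'"
    "same_meets I P' P" "excess h (insert s V) E' < excess h V E"
proof -
  interpret rooted_tree V E q par rk by fact
  have "c q ` (E `` {q}) \<subseteq> {..<h}"
    using col by (auto simp: branch_colouring_def)
  then have "\<not> inj_on (c q) (E `` {q})"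
    using big card_inj_on_le[of "c q" "E `` {q}" "{..<h}"] by auto
  \<comment> \<open>Pigeonhole: \<open>q\<close> has more than \<open>h\<close> branches but only
    \<open>h\<close> colours. No path through \<open>q\<close> uses two branches of equal colour, so
    these two may be merged.\<close>
  then obtain a b where ab: "(q, a) \<in> E" "(q, b) \<in> E" "a \<noteq> b" "c q a = c q b"
    by (auto simp: inj_on_def)
  define E' where "E' = merge E q a b s"
  have ne: "a \<noteq> q" "b \<noteq> q" "s \<noteq> q" "a \<noteq> s" "b \<noteq> s"
    using ab E_neq E_in s root by blast+
  have P: "set (P i) \<subseteq> V" "tpath E (P i)" if "i \<in> I" for i
    using fam that by (auto simp: path_family_def)
  have cinj: "y = z" if "i \<in> I" "{x, y, z} \<subseteq> set (P i)" "(x, y) \<in> E" "(x, z) \<in> E" "c x y = c x z"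
    for i x y z using col that unfolding branch_colouring_def by blast
  have "\<exists>p'. tpath E' p' \<and> set (P i) \<subseteq> set p' \<and> set p' \<subseteq> insert s (set (P i)) \<and>
      (s \<in> set p' \<longrightarrow> q \<in> set (P i) \<and> (a \<in> set (P i) \<or> b \<in> set (P i)))" if i: "i \<in> I" for i
    by (rule merge_path[OF P(2,1)[OF i] _ s, of a b])
      (use cinj[OF i, of q a b] ab E'_def in auto)
  then obtain P' where P': "\<And>i. i \<in> I \<Longrightarrow> tpath E' (P' i)"
    "\<And>i. i \<in> I \<Longrightarrow> set (P i) \<subseteq> set (P' i)" "\<And>i. i \<in> I \<Longrightarrow> set (P' i) \<subseteq> insert s (set (P i))"
    "\<And>i. i \<in> I \<Longrightarrow> s \<in> set (P' i) \<Longrightarrow> q \<in> set (P i) \<and> (a \<in> set (P i) \<or> b \<in> set (P i))"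
    by metis
  \<comment> \<open>At \<open>s\<close> the three branches get the colours 0, 1 and 2, all below
    \<open>h\<close>. At \<open>q\<close> the branch of \<open>s\<close> inherits the common colour
    of \<open>a\<close> and \<open>b\<close>; at \<open>a\<close> and \<open>b\<close> it takes over
    the colour of the branch of \<open>q\<close>.\<close>
  define c' where "c' x y =
    (if x = s then (if y = q then 0 else if y = a then 1 else 2)
     else if y = s then (if x = q then c q a else c x q) else c x y)" for x y
  have tree: "tree_on (insert s V) E'"
    using merge_rooted_tree[OF ab(1,2) s] by (auto simp: tree_on_def E'_def)
  have fam': "path_family (insert s V) E' I P'"
    unfolding path_family_def using tree P'(1) subset_trans[OF P'(3) insert_mono[OF P(1)]] by simp
  have meets: "same_meets I P' P"
    unfolding same_meets_def
  proof (intro ballI)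
    fix i j assume i: "i \<in> I" and j: "j \<in> I"
    \<comment> \<open>A path receives \<open>s\<close> only if it contains \<open>q\<close>, so two
      paths that now meet in \<open>s\<close> met before.\<close>
    have "z \<in> set (P i) \<inter> set (P j) \<or> q \<in> set (P i) \<inter> set (P j)"
      if "z \<in> set (P' i)" "z \<in> set (P' j)" for z
      using P'(3,4)[OF i] P'(3,4)[OF j] that by (cases "z = s") auto
    then show "set (P' i) \<inter> set (P' j) = {} \<longleftrightarrow> set (P i) \<inter> set (P j) = {}"
      using P'(2)[OF i] P'(2)[OF j] by blast
  qed
  note nb = merge_nbrs[OF ab(1,2) s, folded E'_def]
  have E'_iff: "(s, y) \<in> E' \<longleftrightarrow> y \<in> {q, a, b}"
    "(q, y) \<in> E' \<longleftrightarrow> y = s \<or> (q, y) \<in> E \<and> y \<notin> {a, b}" for y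
    using arg_cong[OF nb(1), of "(\<in>) y"] arg_cong[OF nb(2), of "(\<in>) y"] by simp_all
  have E'_ab: "(x, y) \<in> E' \<longleftrightarrow> y = s \<or> (x, y) \<in> E \<and> y \<noteq> q" if "x \<in> {a, b}" for x y
    using arg_cong[OF nb(3)[OF that], of "(\<in>) y"] by simp
  have E'_old: "(x, y) \<in> E' \<longleftrightarrow> (x, y) \<in> E" if "x \<notin> {s, q, a, b}" for x y
    using arg_cong[OF nb(4)[OF that], of "(\<in>) y"] by simp
  have Es: "(x, s) \<notin> E" for x using s E_in by blast
  have aq: "x \<in> {a, b} \<Longrightarrow> (x, q) \<in> E" for x using ab(1,2) E_sym by blast
  have less_h: "c x y < h" if "(x, y) \<in> E" for x y
    using col that by (auto simp: branch_colouring_def)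
  have "c' x y < h" if xy: "(x, y) \<in> E'" for x y
  proof -
    consider "x = s" | "x = q" | "x \<in> {a, b}" | "x \<notin> {s, q, a, b}" by auto
    then show ?thesis
    proof cases
      case 1
      then show ?thesis using h by (auto simp: c'_def)
    next
      case 2
      then show ?thesis using xy less_h[of q y] less_h[OF ab(1)] ne by (auto simp: c'_def E'_iff)
    next
      case 3
      then show ?thesis using xy E'_ab[OF 3] less_h[of x y] less_h[OF aq[OF 3]] ne by (auto simp: c'_def)
    next
      case 4
      then show ?thesis using xy E'_old[OF 4] less_h[of x y] Es[of x] 4 by (auto simp: c'_def)
    qed
  qed
  moreover have "y = z"
    if i: "i \<in> I" and in_P': "{x, y, z} \<subseteq> set (P' i)" and xy: "(x, y) \<in> E'" and xz: "(x, z) \<in> E'"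
      and eq: "c' x y = c' x z" for i x y z
  proof -
    have old: "w \<in> set (P i)" if "w \<in> set (P' i)" "w \<noteq> s" for w
      using P'(3)[OF i] that by auto
    \<comment> \<open>By symmetry only \<open>u\<close> is allowed to be \<open>s\<close>. Seen from
      \<open>q\<close>, the node \<open>s\<close> stands for \<open>a\<close> or \<open>b\<close>;
      seen from \<open>a\<close> or \<open>b\<close>, it stands for \<open>q\<close>. A clash of
      colours would thus be a clash in the old colouring.\<close>
    have *: "u = w" if "x \<noteq> s" "{x, u, w} \<subseteq> set (P' i)" "(x, u) \<in> E'" "(x, w) \<in> E'" "c' x u = c' x w"
      "w \<noteq> s" for u w
    proof (cases "u = s")
      case False
      have "(x, u) \<in> E" "(x, w) \<in> E" "c x u = c x w"
        using that False by (auto simp: E'_def merge_def c'_def)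
      then show ?thesis using cinj[OF i, of x u w] old that False by auto
    next
      case True
      then have S: "q \<in> set (P i)" "a \<in> set (P i) \<or> b \<in> set (P i)"
        using P'(4)[OF i] that by auto
      show ?thesis
      proof (cases "x = q")
        case True
        then have w: "(q, w) \<in> E" "w \<notin> {a, b}" "c q w = c q a" "w \<in> set (P i)"
          using that \<open>u = s\<close> old by (auto simp: E'_iff c'_def)
        then show ?thesis
          using S cinj[OF i, of q w a] cinj[OF i, of q w b] ab by auto
      next
        case False
        then have x: "x \<in> {a, b}"
          using that \<open>u = s\<close> E'_old[of x s] Es by blast
        then have w: "(x, w) \<in> E" "w \<noteq> q" "c x w = c x q" "w \<in> set (P i)" "x \<in> set (P i)"
          using that \<open>u = s\<close> old E'_ab[OF x] False S x by (auto simp: c'_def)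
        then show ?thesis
          using S cinj[OF i, of x w q] aq[OF x] by auto
      qed
    qed
    show ?thesis
    proof (cases "x = s")
      case True
      then show ?thesis using xy xz eq ab ne by (auto simp: E'_iff c'_def)
    next
      case False
      then show ?thesis
        using *[of y z] *[of z y] in_P' xy xz eq by (cases "z = s"; cases "y = s") auto
    qed
  qed
  ultimately have col': "branch_colouring h E' I P' c'"
    unfolding branch_colouring_def by blast
  have deg: "card (E' `` {s}) = 3" "Suc (card (E' `` {q})) = card (E `` {q})"
    "\<And>x. x \<in> V \<Longrightarrow> x \<noteq> q \<Longrightarrow> card (E' `` {x}) = card (E `` {x})"
    using merge_degrees[OF ab(1-3) s, folded E'_def] by auto
  have "excess h (insert s V) E' = excess h V E'"
    using finite_V s h deg(1) by simp
  also have "\<dots> < excess h V E"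
  proof (rule sum_strict_mono_ex1)
    show "\<forall>x\<in>V. card (E' `` {x}) - h \<le> card (E `` {x}) - h"
      using deg(2,3) by (metis diff_le_mono le_refl lessI less_imp_le)
    show "\<exists>x\<in>V. card (E' `` {x}) - h < card (E `` {x}) - h"
      using deg(2) big root by (intro bexI[of _ q]) auto
  qed (rule finite_V)
  finally show thesis using that fam' col' meets by blast
qed

text \<open>Merging is repeated until no degree exceeds \<open>h\<close>; the excess decreases each
  time. Nodes of type \<open>nat\<close> guarantee a fresh node for every step.\<close>

lemma bounded_degree_path_family:
  fixes V :: "nat set"
  assumes "h \<ge> 3" "path_family V E I P" "branch_colouring h E I P c"
  shows "\<exists>(V' :: nat set) E' P'. path_family V' E' I P' \<and> same_meets I P' P \<and>
    (\<forall>x \<in> V'. card (E' `` {x}) \<le> h)"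
  using assms(2,3)
proof (induction "excess h V E" arbitrary: V E P c rule: less_induct)
  case less
  show ?case
  proof (cases "\<forall>x \<in> V. card (E `` {x}) \<le> h")
    case True
    then show ?thesis using less.prems by (auto simp: same_meets_def)
  next
    case False
    then obtain q where q: "q \<in> V" "h < card (E `` {q})" by (auto simp: not_le)
    have "tree_on V E" using less.prems by (simp add: path_family_def)
    then obtain par rk where R: "rooted_tree V E q par rk"
      using tree_on_reroot q by metis
    obtain s where s: "s \<notin> V"
      using rooted_tree.finite_V[OF R] ex_new_if_finite infinite_UNIV_nat by metis
    obtain E' P' c' where "path_family (insert s V) E' I P'" "branch_colouring h E' I P' c'"
      and m: "same_meets I P' P" and "excess h (insert s V) E' < excess h V E"
      using merge_step[OF assms(1) R less.prems q(2) s] by metis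
    then obtain V'' :: "nat set" and E'' P'' where
      "path_family V'' E'' I P''" "same_meets I P'' P'" "\<forall>x \<in> V''. card (E'' `` {x}) \<le> h"
      using less.hyps by meson
    then show ?thesis using m by (auto simp: same_meets_def)
  qed
qed

section \<open>Contraction and minimal representations\<close>

lemma tree_on_sym: "tree_on V E \<Longrightarrow> sym E"
  unfolding tree_on_def by (elim exE) (rule rooted_tree.sym_E)

lemma tree_on_in: "tree_on V E \<Longrightarrow> (x, y) \<in> E \<Longrightarrow> x \<in> V \<and> y \<in> V"
  unfolding tree_on_def by (elim exE) (rule rooted_tree.E_in)

lemma tree_on_finite: "tree_on V E \<Longrightarrow> finite V"
  unfolding tree_on_def by (elim exE) (rule rooted_tree.finite_V)

context rooted_tree
begin

text \<open>The children of \<open>a\<close> become children of \<open>r\<close>. The old rank still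
  works, since it increases from \<open>r\<close> to \<open>a\<close> and from \<open>a\<close> to
  its children.\<close>

lemma contract_rooted_tree:
  assumes "(r, a) \<in> E"
  obtains E' where "tree_on (V - {a}) E'"
    "\<And>x y. (x, y) \<in> E \<Longrightarrow> x \<noteq> a \<Longrightarrow> y \<noteq> a \<Longrightarrow> (x, y) \<in> E'"
    "\<And>y. (a, y) \<in> E \<Longrightarrow> y \<noteq> r \<Longrightarrow> (r, y) \<in> E'"
proof -
  have a: "a \<in> V" "a \<noteq> r" "par a = r" using assms E_root by auto
  let ?par = "\<lambda>x. if par x = a then r else par x"
  let ?E = "{(x, y). x \<in> V - {a} \<and> x \<noteq> r \<and> y = ?par x \<or> y \<in> V - {a} \<and> y \<noteq> r \<and> x = ?par y}"
  have "rooted_tree (V - {a}) ?E r ?par rk"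
  proof
    fix x assume x: "x \<in> V - {a}" "x \<noteq> r"
    show "?par x \<in> V - {a}" using x a root par_in[of x] by auto
    show "rk (?par x) < rk x"
      using rk_par[of x] rk_par[of a] x a by auto
  qed (use finite_V root a in auto)
  then have "tree_on (V - {a}) ?E" unfolding tree_on_def by blast
  moreover have "(x, y) \<in> ?E" if "(x, y) \<in> E" "x \<noteq> a" "y \<noteq> a" for x y
    using that E_iff[of x y] by auto
  moreover have "(r, y) \<in> ?E" if "(a, y) \<in> E" "y \<noteq> r" for y
    using that E_iff[of a y] a by auto
  ultimately show thesis by (rule that)
qed

text \<open>On a path starting at the root \<open>a\<close> can only be the next node, so dropping
  it joins the root to a former neighbour of \<open>a\<close>.\<close>

lemma contract_path_from_root:
  assumes "tpath E (r # q)" "(r, a) \<in> E"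
    and E': "\<And>x y. (x, y) \<in> E \<Longrightarrow> x \<noteq> a \<Longrightarrow> y \<noteq> a \<Longrightarrow> (x, y) \<in> E'"
      "\<And>y. (a, y) \<in> E \<Longrightarrow> y \<noteq> r \<Longrightarrow> (r, y) \<in> E'"
  shows "tpath E' (r # filter (\<lambda>x. x \<noteq> a) q)"
proof -
  have ar: "a \<noteq> r" using assms(2) E_neq by blast
  have s: "successively (\<lambda>x y. (x, y) \<in> E) (r # q)" and d: "distinct (r # q)"
    using assms(1) by (simp_all add: tpath_def)
  have mono: "successively (\<lambda>x y. (x, y) \<in> E') p"
    if "successively (\<lambda>x y. (x, y) \<in> E) p" "a \<notin> set p" for p
    using that(1) by (rule successively_mono) (use that(2) in \<open>metis E'(1)\<close>)
  show ?thesis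
  proof (cases "a \<in> set q")
    case False
    then have "filter (\<lambda>x. x \<noteq> a) q = q" by (auto intro: filter_True)
    then show ?thesis using mono[OF s] False ar d by (simp add: tpath_def)
  next
    case True
    then have "hd q = a"
      using path_from_root(2)[OF assms(1) True] top_nbr[OF assms(2)] by simp
    then obtain q2 where q: "q = a # q2" using True by (cases q) auto
    then have f: "filter (\<lambda>x. x \<noteq> a) q = q2" using d by (auto intro: filter_True)
    have "successively (\<lambda>x y. (x, y) \<in> E') q2"
      using s d mono[of q2] q by (cases q2) auto
    moreover have "q2 \<noteq> [] \<Longrightarrow> (r, hd q2) \<in> E'"
      using s d E'(2)[of "hd q2"] q by (cases q2) auto
    ultimately show ?thesis
      unfolding f using d q by (auto simp: tpath_def successively_Cons)
  qed
qed

text \<open>Deleting \<open>a\<close> from all paths loses no intersection, because paths meeting in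
  \<open>a\<close> also meet in \<open>r\<close>. A path containing \<open>a\<close> passes through
  \<open>r\<close>, so its two halves can be contracted separately.\<close>

lemma contract_path_family:
  assumes a: "(r, a) \<in> E" and fam: "path_family V E I P"
    and sub: "\<And>i. i \<in> I \<Longrightarrow> a \<in> set (P i) \<Longrightarrow> r \<in> set (P i)"
  shows "\<exists>E' P'. path_family (V - {a}) E' I P' \<and> same_meets I P' P"
proof -
  obtain E' where tree: "tree_on (V - {a}) E'"
    and E': "\<And>x y. (x, y) \<in> E \<Longrightarrow> x \<noteq> a \<Longrightarrow> y \<noteq> a \<Longrightarrow> (x, y) \<in> E'"
      "\<And>y. (a, y) \<in> E \<Longrightarrow> y \<noteq> r \<Longrightarrow> (r, y) \<in> E'"
    by (rule contract_rooted_tree[OF a]) blast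
  have symE': "sym E'" by (rule tree_on_sym[OF tree])
  have ar: "a \<noteq> r" using a E_neq by blast
  define P' where "P' i = filter (\<lambda>x. x \<noteq> a) (P i)" for i
  have path: "tpath E' (P' i)" if i: "i \<in> I" for i
  proof (cases "a \<in> set (P i)")
    case False
    have t: "tpath E (P i)" using fam i by (simp add: path_family_def)
    have "P' i = P i" using False by (auto simp: P'_def filter_id_conv)
    moreover have "successively (\<lambda>x y. (x, y) \<in> E) (P i)" using t by (simp add: tpath_def)
    then have "successively (\<lambda>x y. (x, y) \<in> E') (P i)"
      by (rule successively_mono) (use False in \<open>metis E'(1)\<close>)
    ultimately show ?thesis using t by (simp add: tpath_def)
  next
    case True
    have t: "tpath E (P i)" using fam i by (simp add: path_family_def)
    obtain p1 p2 where p: "P i = p1 @ r # p2"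
      and t12: "tpath E (r # p2)" "tpath E (r # rev p1)" and disj: "set p1 \<inter> set p2 = {}"
      using path_through_root[OF t sub[OF i True]] by metis
    have "tpath E' (rev (filter (\<lambda>x. x \<noteq> a) (rev p1)) @ r # filter (\<lambda>x. x \<noteq> a) p2)"
      by (rule tpath_join[OF symE' contract_path_from_root[OF t12(2) a E']
            contract_path_from_root[OF t12(1) a E']]) (use disj in auto)
    then show ?thesis using ar by (simp add: P'_def p rev_filter)
  qed
  have set_P': "set (P' i) = set (P i) - {a}" for i by (auto simp: P'_def)
  have "path_family (V - {a}) E' I P'"
    using fam path tree set_P' unfolding path_family_def by blast
  moreover have "same_meets I P' P"
    unfolding same_meets_def set_P' using sub ar by blast
  ultimately show ?thesis by blast
qed

end

section \<open>Representations in terms of node set and edge relation\<close>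

definition represents ::
  "('a, 'b) pre_digraph \<Rightarrow> 'c set \<Rightarrow> 'c rel \<Rightarrow> ('a \<Rightarrow> 'c list) \<Rightarrow> bool" where
  "represents G V E P \<longleftrightarrow> path_family V E (verts G) P \<and>
     (\<forall>u \<in> verts G. \<forall>v \<in> verts G. u \<noteq> v \<longrightarrow>
        (u \<rightarrow>\<^bsub>G\<^esub> v \<longleftrightarrow> set (P u) \<inter> set (P v) \<noteq> {}))"

lemma VPT_representation_iff:
  "VPT_representation G (with_proj T) P \<longleftrightarrow> represents G (pverts T) (parcs T) P"
  unfolding VPT_representation_def represents_def path_family_def
    tree_on_iff_undirected_tree vpath_iff_tpath by auto

lemma out_degree_with_proj: "out_degree (with_proj T) x = card (parcs T `` {x})"
proof -
  have "out_arcs (with_proj T) x = Pair x ` (parcs T `` {x})"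
    by (auto simp: out_arcs_def)
  then show ?thesis by (simp add: out_degree_def card_image inj_on_def)
qed

lemma ex_pair_digraph: "(\<exists>T :: 'c pair_pre_digraph. Q (pverts T) (parcs T)) \<longleftrightarrow> (\<exists>V E. Q V E)"
  by (metis pair_pre_digraph.select_convs(1,2))

lemma VPT_iff_represents:
  "VPT G \<longleftrightarrow> (\<exists>(V :: nat set) E P. represents G V E P)"
  unfolding VPT_def VPT_representation_iff
  using ex_pair_digraph[of "\<lambda>V E. \<exists>P. represents G V E P"] by auto

lemma in_h21_iff_represents:
  "in_h21 h G \<longleftrightarrow>
    (\<exists>(V :: nat set) E P. represents G V E P \<and> (\<forall>x \<in> V. card (E `` {x}) \<le> h))"
  unfolding in_h21_def VPT_representation_iff out_degree_with_proj with_proj_simps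
  using ex_pair_digraph[of "\<lambda>V E. \<exists>P. represents G V E P \<and> (\<forall>x \<in> V. card (E `` {x}) \<le> h)"]
  by auto

lemma represents_same_meets:
  assumes "represents G V E P" "path_family V' E' (verts G) P'" "same_meets (verts G) P' P"
  shows "represents G V' E' P'"
  using assms unfolding represents_def same_meets_def by simp

lemma branch_colouring_in_h21:
  fixes V :: "nat set"
  assumes "h \<ge> 3" "represents G V E P" "branch_colouring h E (verts G) P c"
  shows "in_h21 h G"
proof -
  obtain V' :: "nat set" and E' P' where "path_family V' E' (verts G) P'"
    "same_meets (verts G) P' P" "\<forall>x \<in> V'. card (E' `` {x}) \<le> h"
    using bounded_degree_path_family assms unfolding represents_def by metis
  then show ?thesis
    using represents_same_meets[OF assms(2)] unfolding in_h21_iff_represents by blast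
qed

lemma minimal_representation:
  assumes "VPT G"
  shows "\<exists>(V :: nat set) E P. represents G V E P \<and>
    (\<forall>x y. (x, y) \<in> E \<longrightarrow> (\<exists>v \<in> verts G. y \<in> set (P v) \<and> x \<notin> set (P v)))"
proof -
  let ?R = "\<lambda>(V :: nat set, E, P). represents G V E P"
  have "\<exists>t. ?R t" using assms by (auto simp: VPT_iff_represents)
  then obtain t where t: "?R t" and least: "\<And>t'. ?R t' \<Longrightarrow> card (fst t) \<le> card (fst t')"
    using ex_has_least_nat[of ?R _ "\<lambda>t. card (fst t)"] by blast
  obtain V E P where t_eq: "t = (V, E, P)" by (cases t)
  then have rep: "represents G V E P" using t by simp
  have "\<exists>v \<in> verts G. y \<in> set (P v) \<and> x \<notin> set (P v)" if xy: "(x, y) \<in> E" for x y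
  proof (rule ccontr)
    assume not: "\<not> (\<exists>v \<in> verts G. y \<in> set (P v) \<and> x \<notin> set (P v))"
    have fam: "path_family V E (verts G) P" using rep by (simp add: represents_def)
    then have tr: "tree_on V E" by (simp add: path_family_def)
    then have V: "x \<in> V" "y \<in> V" "finite V"
      using tree_on_in[OF tr xy] tree_on_finite[OF tr] by simp_all
    \<comment> \<open>Contraction is available at the root, so the tree is rerooted at
      \<open>x\<close>.\<close>
    then obtain par rk where "rooted_tree V E x par rk"
      using tree_on_reroot[OF tr] by blast
    then obtain E' P' where "path_family (V - {y}) E' (verts G) P'" "same_meets (verts G) P' P"
      using rooted_tree.contract_path_family[OF _ xy fam] not by metis
    then have "represents G (V - {y}) E' P'" using represents_same_meets[OF rep] by blast
    then have "card V \<le> card (V - {y})" using least[of "(V - {y}, E', P')"] t_eq by simp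
    then show False using V by (metis card_Diff1_less not_le)
  qed
  then show ?thesis using rep by blast
qed

text \<open>What \<open>branch_colouring\<close> demands at a node involves only the branches at
  that node, so colourings chosen node by node would combine and put \<open>G\<close> into the
  class. Starting from \<open>minimal_representation\<close> ensures that every neighbour of the
  uncolourable node has a path avoiding that node.\<close>

lemma uncolourable_branches:
  assumes "VPT G" "\<not> in_h21 h G" "h \<ge> 3"
  shows "\<exists>(V :: nat set) E P q. represents G V E P \<and> q \<in> V \<and>
    (\<forall>a. (q, a) \<in> E \<longrightarrow> (\<exists>v \<in> verts G. a \<in> set (P v) \<and> q \<notin> set (P v))) \<and>
    (\<forall>c :: nat \<Rightarrow> nat. (\<forall>a. (q, a) \<in> E \<longrightarrow> c a < h) \<longrightarrow> (\<exists>v \<in> verts G. \<exists>a b.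
      {q, a, b} \<subseteq> set (P v) \<and> (q, a) \<in> E \<and> (q, b) \<in> E \<and> a \<noteq> b \<and> c a = c b))"
proof -
  obtain V :: "nat set" and E P where rep: "represents G V E P"
    and min: "\<forall>x y. (x, y) \<in> E \<longrightarrow> (\<exists>v \<in> verts G. y \<in> set (P v) \<and> x \<notin> set (P v))"
    using minimal_representation[OF assms(1)] by (elim exE conjE)
  define bad where "bad x c \<longleftrightarrow> (\<forall>a. (x, a) \<in> E \<longrightarrow> c a < h) \<longrightarrow>
    (\<exists>v \<in> verts G. \<exists>a b. {x, a, b} \<subseteq> set (P v) \<and> (x, a) \<in> E \<and> (x, b) \<in> E \<and> a \<noteq> b \<and> c a = c b)"
    for x and c :: "nat \<Rightarrow> nat"
  have "\<exists>q \<in> V. \<forall>c. bad q c"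
  proof (rule ccontr)
    assume "\<not> ?thesis"
    then have "\<forall>q \<in> V. \<exists>c. \<not> bad q c" by blast
    then have "\<exists>c. \<forall>q \<in> V. \<not> bad q (c q)" by (rule bchoice)
    then obtain c where c: "\<And>q. q \<in> V \<Longrightarrow> \<not> bad q (c q)" by blast
    have fam: "path_family V E (verts G) P" using rep by (simp add: represents_def)
    then have EV: "x \<in> V" if "(x, y) \<in> E" for x y
      using that tree_on_in unfolding path_family_def by metis
    have "branch_colouring h E (verts G) P c"
      unfolding branch_colouring_def
    proof (intro conjI allI impI ballI)
      fix x y assume "(x, y) \<in> E"
      then show "c x y < h" using c[OF EV] unfolding bad_def by blast
    next
      fix v x y z
      assume "v \<in> verts G" "x \<in> set (P v)" "y \<in> set (P v)" "z \<in> set (P v)"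
        "(x, y) \<in> E" "(x, z) \<in> E" "c x y = c x z"
      then show "y = z" using c[OF EV[OF \<open>(x, y) \<in> E\<close>]] unfolding bad_def by blast
    qed
    then show False using branch_colouring_in_h21[OF assms(3) rep] assms(2) by simp
  qed
  then obtain q where q: "q \<in> V" and bad: "\<forall>c. bad q c" by blast
  have "\<forall>c :: nat \<Rightarrow> nat. (\<forall>a. (q, a) \<in> E \<longrightarrow> c a < h) \<longrightarrow> (\<exists>v \<in> verts G. \<exists>a b.
      {q, a, b} \<subseteq> set (P v) \<and> (q, a) \<in> E \<and> (q, b) \<in> E \<and> a \<noteq> b \<and> c a = c b)"
    using bad unfolding bad_def .
  then show ?thesis using rep q min by (intro exI[of _ V] exI[of _ E] exI[of _ P] exI[of _ q] conjI spec[OF min]) 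
qed

section \<open>Critical graphs\<close>

lemma arcs_ends_del_vert:
  "arcs_ends (pre_digraph.del_vert G v) = {(x, y). x \<rightarrow>\<^bsub>G\<^esub> y \<and> x \<noteq> v \<and> y \<noteq> v}"
  unfolding arcs_ends_conv pre_digraph.del_vert_simps by blast

lemma arcs_ends_del_edge: "arcs_ends (del_edge G u v) = arcs_ends G - {(u, v), (v, u)}"
proof -
  have "arc_to_ends (del_edge G u v) = arc_to_ends G"
    by (simp add: del_edge_def arc_to_ends_def fun_eq_iff)
  moreover have "arcs (del_edge G u v) = {a \<in> arcs G. arc_to_ends G a \<notin> {(u, v), (v, u)}}"
    by (simp add: del_edge_def)
  ultimately show ?thesis unfolding arcs_ends_def by auto
qed

lemma verts_del_edge: "verts (del_edge G u v) = verts G"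
  by (simp add: del_edge_def)

text \<open>As \<open>chromatic_number\<close> is a least element, some colouring must be exhibited
  first; an injective numbering of the finitely many vertices is one.\<close>

lemma chromatic_number_le_iff:
  assumes "finite (verts G)" "\<And>u v. u \<rightarrow>\<^bsub>G\<^esub> v \<Longrightarrow> u \<in> verts G \<and> v \<in> verts G \<and> u \<noteq> v"
  shows "chromatic_number G \<le> k \<longleftrightarrow> (\<exists>c. proper_colouring G k c)"
proof
  obtain f :: "'a \<Rightarrow> nat" and n where f: "inj_on f (verts G)" "f ` verts G = {i. i < n}"
    using finite_imp_inj_to_nat_seg[OF assms(1)] by (elim exE conjE)
  have "proper_colouring G n f"
    unfolding proper_colouring_def
  proof (intro conjI ballI allI impI)
    fix v assume "v \<in> verts G"
    then have "f v \<in> {i. i < n}" unfolding f(2)[symmetric] by (rule imageI)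
    then show "f v < n" by simp
  next
    fix u v assume "u \<rightarrow>\<^bsub>G\<^esub> v"
    then show "f u \<noteq> f v" using assms(2)[of u v] inj_on_eq_iff[OF f(1), of u v] by simp
  qed
  then have "\<exists>c. proper_colouring G n c" by blast
  then have "\<exists>c. proper_colouring G (chromatic_number G) c"
    unfolding chromatic_number_def by (rule LeastI[where P = "\<lambda>k. \<exists>c. proper_colouring G k c"])
  then obtain c where "proper_colouring G (chromatic_number G) c" by blast
  moreover assume "chromatic_number G \<le> k"
  ultimately have "proper_colouring G k c"
    by (auto simp: proper_colouring_def intro: order_less_le_trans)
  then show "\<exists>c. proper_colouring G k c" by blast
next
  assume "\<exists>c. proper_colouring G k c"
  then show "chromatic_number G \<le> k" unfolding chromatic_number_def by (rule Least_le)
qed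

lemma proper_colouring_del_vert:
  "proper_colouring (pre_digraph.del_vert G v) k c \<longleftrightarrow>
    (\<forall>x \<in> verts G - {v}. c x < k) \<and> (\<forall>x y. x \<rightarrow>\<^bsub>G\<^esub> y \<longrightarrow> x \<noteq> v \<longrightarrow> y \<noteq> v \<longrightarrow> c x \<noteq> c y)"
  unfolding proper_colouring_def arcs_ends_del_vert pre_digraph.verts_del_vert by (simp, blast)

context graph
begin

lemma arc_ends_distinct: "u \<rightarrow> v \<Longrightarrow> u \<in> verts G \<and> v \<in> verts G \<and> u \<noteq> v"
  using adj_in_verts adj_not_same by blast

lemma critical_iff:
  "critical (Suc k) G \<longleftrightarrow>
     (\<nexists>c. proper_colouring G k c) \<and> (\<exists>c. proper_colouring G (Suc k) c) \<and>
     (\<forall>v \<in> verts G. \<exists>c. proper_colouring (del_vert v) k c) \<and>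
     (\<forall>u v. u \<rightarrow> v \<longrightarrow> (\<exists>c. proper_colouring (del_edge G u v) k c))"
proof -
  have 1: "chromatic_number G \<le> j \<longleftrightarrow> (\<exists>c. proper_colouring G j c)" for j
    by (rule chromatic_number_le_iff) (use arc_ends_distinct in auto)
  have 2: "chromatic_number (del_vert v) \<le> j \<longleftrightarrow> (\<exists>c. proper_colouring (del_vert v) j c)" for j v
    by (rule chromatic_number_le_iff)
      (use arc_ends_distinct in \<open>auto simp: arcs_ends_del_vert verts_del_vert\<close>)
  have 3: "chromatic_number (del_edge G u v) \<le> j \<longleftrightarrow> (\<exists>c. proper_colouring (del_edge G u v) j c)"
    for j u v
    by (rule chromatic_number_le_iff)
      (use arc_ends_distinct in \<open>auto simp: arcs_ends_del_edge verts_del_edge\<close>)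
  have "chromatic_number G = Suc k \<longleftrightarrow>
      \<not> chromatic_number G \<le> k \<and> chromatic_number G \<le> Suc k" by auto
  then show ?thesis unfolding critical_def less_Suc_eq_le 1 2 3 by simp
qed

text \<open>If \<open>v\<close> had fewer than \<open>k\<close> neighbours, a
  \<open>k\<close>-colouring of the rest would leave a colour free for \<open>v\<close>.\<close>

lemma critical_min_degree:
  assumes "critical (Suc k) G" "v \<in> verts G"
  shows "k \<le> card {w. v \<rightarrow> w}"
proof (rule ccontr)
  let ?N = "{w. v \<rightarrow> w}"
  assume small: "\<not> k \<le> card ?N"
  have fin: "finite ?N" by (rule finite_subset[OF _ finite_verts]) (use arc_ends_distinct in blast)
  obtain c where "proper_colouring (del_vert v) k c"
    using assms critical_iff by blast
  then have c: "\<And>x. x \<in> verts G \<Longrightarrow> x \<noteq> v \<Longrightarrow> c x < k"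
    "\<And>x y. x \<rightarrow> y \<Longrightarrow> x \<noteq> v \<Longrightarrow> y \<noteq> v \<Longrightarrow> c x \<noteq> c y"
    unfolding proper_colouring_del_vert by auto
  have "card (c ` ?N) < card {..<k}" using small card_image_le[OF fin, of c] by simp
  then obtain j where j: "j < k" "j \<notin> c ` ?N"
    by (metis card_mono finite_imageI fin not_le subsetI lessThan_iff)
  have "proper_colouring G k (c(v := j))"
    unfolding proper_colouring_def
  proof (intro conjI ballI allI impI)
    fix x assume "x \<in> verts G"
    then show "(c(v := j)) x < k" using c(1) j by simp
  next
    fix x y assume "x \<rightarrow> y"
    moreover have "y \<rightarrow> x" using graph_symmetric calculation by simp
    ultimately show "(c(v := j)) x \<noteq> (c(v := j)) y"
      using c(2)[of x y] j(2) adj_not_same by auto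
  qed
  then show False using assms(1) critical_iff by blast
qed

end

text \<open>Among the symmetric subgraphs without a \<open>k\<close>-colouring take one with the
  least sum of the numbers of vertices and arcs. Everything smaller is \<open>k\<close>-colourable,
  which gives criticality and, by colouring parts separately, connectedness.\<close>

lemma ex_critical_subgraph:
  fixes A :: "'c set" and F :: "'c rel"
  assumes A: "finite A" and F: "F \<subseteq> A \<times> A" "sym F" "irrefl F"
    and not: "\<nexists>c. proper_colouring (with_proj \<lparr>pverts = A, parcs = F\<rparr>) k c"
  shows "\<exists>H :: 'c pair_pre_digraph. graph (with_proj H) \<and> connected (with_proj H) \<and>
    critical (Suc k) (with_proj H) \<and> pverts H \<subseteq> A \<and> parcs H \<subseteq> F"
proof -
  define bad where "bad H \<longleftrightarrow> pverts H \<subseteq> A \<and> parcs H \<subseteq> F \<and> parcs H \<subseteq> pverts H \<times> pverts H \<and>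
    sym (parcs H) \<and> (\<nexists>c. proper_colouring (with_proj H) k c)" for H :: "'c pair_pre_digraph"
  let ?size = "\<lambda>H :: 'c pair_pre_digraph. card (pverts H) + card (parcs H)"
  have "bad \<lparr>pverts = A, parcs = F\<rparr>" using F not by (simp add: bad_def)
  then obtain H where H: "bad H" and least: "\<And>H'. bad H' \<Longrightarrow> ?size H \<le> ?size H'"
    using ex_has_least_nat[of bad _ ?size] by blast
  have sub: "pverts H \<subseteq> A" "parcs H \<subseteq> F" "parcs H \<subseteq> pverts H \<times> pverts H" "sym (parcs H)"
    and notH: "\<nexists>c. proper_colouring (with_proj H) k c"
    using H by (simp_all add: bad_def)
  have fin: "finite (pverts H)" "finite (parcs H)"
    using sub A by (meson finite_subset finite_SigmaI)+
  have irr: "u \<noteq> v" if "(u, v) \<in> parcs H" for u v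
    using that sub(2) F(3) unfolding irrefl_def by blast
  have "pair_graph H"
    by unfold_locales (use sub fin irr in \<open>auto simp: symmetric_def\<close>)
  then have "graph (with_proj H)"
  proof -
    assume "pair_graph H"
    then interpret pair_graph H .
    show ?thesis by unfold_locales
  qed
  then interpret g: graph "with_proj H" .
  have smaller: "\<exists>c. (\<forall>x \<in> B. c x < k) \<and> (\<forall>x y. (x, y) \<in> D \<longrightarrow> c x \<noteq> c y)"
    if "B \<subseteq> pverts H" "D \<subseteq> parcs H" "D \<subseteq> B \<times> B" "sym D" "B \<noteq> pverts H \<or> D \<noteq> parcs H" for B D
  proof (rule ccontr)
    assume "\<not> ?thesis"
    then have "bad \<lparr>pverts = B, parcs = D\<rparr>"
      using that sub by (auto simp: bad_def proper_colouring_def)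
    then have le: "?size H \<le> card B + card D" using least by fastforce
    have "card B \<le> card (pverts H)" "card D \<le> card (parcs H)"
      using that fin by (auto intro: card_mono)
    then have "card B = card (pverts H)" "card D = card (parcs H)" using le by auto
    then show False using that fin card_subset_eq by metis
  qed
  have del_vert: "\<exists>c. proper_colouring (pre_digraph.del_vert (with_proj H) v) k c" if v: "v \<in> pverts H" for v
  proof -
    let ?D = "{(x, y) \<in> parcs H. x \<noteq> v \<and> y \<noteq> v}"
    have "\<exists>c. (\<forall>x \<in> pverts H - {v}. c x < k) \<and> (\<forall>x y. (x, y) \<in> ?D \<longrightarrow> c x \<noteq> c y)"
      by (rule smaller) (use sub v in \<open>auto simp: sym_def\<close>)
    then show ?thesis unfolding proper_colouring_del_vert by auto
  qed
  have del_edge: "\<exists>c. proper_colouring (del_edge (with_proj H) u v) k c" if uv: "(u, v) \<in> parcs H" for u v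
  proof -
    let ?D = "parcs H - {(u, v), (v, u)}"
    have "\<exists>c. (\<forall>x \<in> pverts H. c x < k) \<and> (\<forall>x y. (x, y) \<in> ?D \<longrightarrow> c x \<noteq> c y)"
      by (rule smaller) (use sub uv in \<open>auto simp: sym_def\<close>)
    then show ?thesis
      unfolding proper_colouring_def arcs_ends_del_edge verts_del_edge by simp
  qed
  have ne: "pverts H \<noteq> {}"
    using notH sub(3) by (auto simp: proper_colouring_def)
  have "\<exists>c. proper_colouring (with_proj H) (Suc k) c"
  proof -
    obtain v where v: "v \<in> pverts H" using ne by blast
    then obtain c where "proper_colouring (pre_digraph.del_vert (with_proj H) v) k c" using del_vert by blast
    then have c: "\<And>x. x \<in> pverts H \<Longrightarrow> x \<noteq> v \<Longrightarrow> c x < k"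
      "\<And>x y. (x, y) \<in> parcs H \<Longrightarrow> x \<noteq> v \<Longrightarrow> y \<noteq> v \<Longrightarrow> c x \<noteq> c y"
      unfolding proper_colouring_del_vert by auto
    \<comment> \<open>The additional colour \<open>k\<close> is spent on the one vertex that was
      left out.\<close>
    have "proper_colouring (with_proj H) (Suc k) (c(v := k))"
      unfolding proper_colouring_def
    proof (intro conjI ballI allI impI)
      fix x assume "x \<in> verts (with_proj H)"
      then show "(c(v := k)) x < Suc k" using c(1)[of x] by auto
    next
      fix x y assume "x \<rightarrow>\<^bsub>with_proj H\<^esub> y"
      then have "(x, y) \<in> parcs H" "x \<in> pverts H" "y \<in> pverts H" "x \<noteq> y" using sub irr by auto
      then show "(c(v := k)) x \<noteq> (c(v := k)) y"
        using c(1)[of x] c(1)[of y] c(2)[of x y] by auto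
    qed
    then show ?thesis by blast
  qed
  then have crit: "critical (Suc k) (with_proj H)"
    using notH del_vert del_edge unfolding g.critical_iff by simp
  have "strongly_connected (with_proj H)"
  proof
    show "verts (with_proj H) \<noteq> {}" using ne by simp
    fix u v assume u: "u \<in> verts (with_proj H)" and v: "v \<in> verts (with_proj H)"
    \<comment> \<open>If the part reachable from \<open>u\<close> were not everything, it and its
      complement would be \<open>k\<close>-colourable; as no arc joins them, the two colourings
      would combine.\<close>
    define R where "R = {x \<in> pverts H. (u, x) \<in> (parcs H)\<^sup>*}"
    have closed: "x \<in> R \<longleftrightarrow> y \<in> R" if "(x, y) \<in> parcs H" for x y
    proof -
      have "(y, x) \<in> parcs H" using that sub(4) by (meson symD)
      then show ?thesis using that sub(3) unfolding R_def by (auto intro: rtrancl_into_rtrancl)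
    qed
    have uR: "u \<in> R" using u by (simp add: R_def)
    have "R = pverts H"
    proof (rule ccontr)
      assume RH: "R \<noteq> pverts H"
      have "\<exists>c. (\<forall>x \<in> R. c x < k) \<and> (\<forall>x y. (x, y) \<in> parcs H \<inter> R \<times> R \<longrightarrow> c x \<noteq> c y)"
        by (rule smaller) (use sub(4) RH in \<open>auto simp: R_def sym_def\<close>)
      then obtain c1 where c1: "\<And>x. x \<in> R \<Longrightarrow> c1 x < k"
        "\<And>x y. (x, y) \<in> parcs H \<Longrightarrow> x \<in> R \<Longrightarrow> y \<in> R \<Longrightarrow> c1 x \<noteq> c1 y" by auto
      let ?S = "pverts H - R"
      have "\<exists>c. (\<forall>x \<in> ?S. c x < k) \<and> (\<forall>x y. (x, y) \<in> parcs H \<inter> ?S \<times> ?S \<longrightarrow> c x \<noteq> c y)"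
        by (rule smaller) (use sub(4) uR u in \<open>auto simp: sym_def\<close>)
      then obtain c2 where c2: "\<And>x. x \<in> pverts H \<Longrightarrow> x \<notin> R \<Longrightarrow> c2 x < k"
        "\<And>x y. (x, y) \<in> parcs H \<inter> ?S \<times> ?S \<Longrightarrow> c2 x \<noteq> c2 y" by auto
      have "proper_colouring (with_proj H) k (\<lambda>x. if x \<in> R then c1 x else c2 x)"
        unfolding proper_colouring_def
      proof (intro conjI ballI allI impI)
        fix x assume "x \<in> verts (with_proj H)"
        then show "(if x \<in> R then c1 x else c2 x) < k" using c1(1) c2(1) by simp
      next
        fix x y assume "x \<rightarrow>\<^bsub>with_proj H\<^esub> y"
        then have xy: "(x, y) \<in> parcs H" "x \<in> pverts H" "y \<in> pverts H" using sub(3) by auto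
        then show "(if x \<in> R then c1 x else c2 x) \<noteq> (if y \<in> R then c1 y else c2 y)"
          using closed[OF xy(1)] c1(2)[OF xy(1)] c2(2)[of x y] by simp
      qed
      then show False using notH by blast
    qed
    then have "(u, v) \<in> (parcs H)\<^sup>*" using v by (auto simp: R_def)
    then show "u \<rightarrow>\<^sup>*\<^bsub>with_proj H\<^esub> v" using u v by (simp add: g.reachable_conv)
  qed
  then have "connected (with_proj H)"
    by (rule strongly_connected_connected[OF g.graph_axioms])
  then show ?thesis using g.graph_axioms crit sub by blast
qed

section \<open>Induced subgraphs and split graphs\<close>

context rooted_tree
begin

lemma top_in: "x \<in> V \<Longrightarrow> x \<noteq> r \<Longrightarrow> (r, top x) \<in> E"
proof (induction "rk x" arbitrary: x rule: less_induct)
  case less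
  show ?case
  proof (cases "par x = r")
    case True
    then show ?thesis using less.prems top_child[of x] E_root by simp
  next
    case False
    then show ?thesis
      using less.hyps[OF rk_par par_in] less.prems top_par[of x] by simp
  qed
qed

text \<open>From any node in a set closed under parents one climbs along the path, inside the set,
  to the topmost node. So this one node witnesses every such intersection.\<close>

lemma path_apex_closed:
  assumes "tpath E p"
  shows "\<exists>t \<in> set p. \<forall>S. par_closed S \<longrightarrow> set p \<inter> S \<noteq> {} \<longrightarrow> t \<in> S"
proof -
  obtain t where t: "t \<in> set p"
    "\<And>z. z \<in> set p \<Longrightarrow> z \<noteq> t \<Longrightarrow> z \<in> V \<and> z \<noteq> r \<and> par z \<in> set p"
    using path_apex[of p] assms unfolding tpath_def by blast
  have "t \<in> S" if S: "par_closed S" and "z \<in> set p" "z \<in> S" for S z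
    using that(2,3)
  proof (induction "rk z" arbitrary: z rule: less_induct)
    case less
    show ?case
    proof (cases "z = t")
      case False
      then have z: "z \<in> V" "z \<noteq> r" "par z \<in> set p" using t(2) less.prems by auto
      then have "par z \<in> S" using S less.prems by (simp add: par_closed_def)
      then show ?thesis using less.hyps rk_par z by blast
    qed (use less in simp)
  qed
  then show ?thesis using t(1) by blast
qed

end

text \<open>Induced subgraphs up to renaming of vertices. Only the ends of arcs are compared, so the
  arc types may differ.\<close>

definition embeds :: "('a \<Rightarrow> 'c) \<Rightarrow> ('a, 'b) pre_digraph \<Rightarrow> ('c, 'd) pre_digraph \<Rightarrow> bool" where
  "embeds \<psi> G' G \<longleftrightarrow> inj_on \<psi> (verts G') \<and> \<psi> ` verts G' \<subseteq> verts G \<and>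
     (\<forall>u \<in> verts G'. \<forall>v \<in> verts G'. u \<noteq> v \<longrightarrow> (u \<rightarrow>\<^bsub>G'\<^esub> v \<longleftrightarrow> \<psi> u \<rightarrow>\<^bsub>G\<^esub> \<psi> v))"

lemma embeds_in_h21:
  assumes emb: "embeds \<psi> G' G" and "in_h21 h G"
  shows "in_h21 h G'"
proof -
  obtain V :: "nat set" and E P where rep: "represents G V E P" and deg: "\<forall>x \<in> V. card (E `` {x}) \<le> h"
    using assms(2) unfolding in_h21_iff_represents by blast
  have \<psi>: "\<psi> v \<in> verts G" if "v \<in> verts G'" for v
    using emb that unfolding embeds_def by blast
  have "represents G' V E (P \<circ> \<psi>)"
    unfolding represents_def path_family_def
  proof (intro conjI ballI impI)
    show "tree_on V E" using rep by (simp add: represents_def path_family_def)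
    fix u assume u: "u \<in> verts G'"
    then show "set ((P \<circ> \<psi>) u) \<subseteq> V" "tpath E ((P \<circ> \<psi>) u)"
      using rep \<psi> by (simp_all add: represents_def path_family_def)
    fix v assume v: "v \<in> verts G'" and uv: "u \<noteq> v"
    have "\<psi> u \<noteq> \<psi> v" using emb u v uv unfolding embeds_def by (metis inj_onD)
    then have "\<psi> u \<rightarrow>\<^bsub>G\<^esub> \<psi> v \<longleftrightarrow> set (P (\<psi> u)) \<inter> set (P (\<psi> v)) \<noteq> {}"
      using rep \<psi>[OF u] \<psi>[OF v] unfolding represents_def by metis
    moreover have "u \<rightarrow>\<^bsub>G'\<^esub> v \<longleftrightarrow> \<psi> u \<rightarrow>\<^bsub>G\<^esub> \<psi> v"
      using emb u v uv unfolding embeds_def by metis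
    ultimately show "u \<rightarrow>\<^bsub>G'\<^esub> v \<longleftrightarrow> set ((P \<circ> \<psi>) u) \<inter> set ((P \<circ> \<psi>) v) \<noteq> {}" by simp
  qed
  then show ?thesis using deg unfolding in_h21_iff_represents by blast
qed

text \<open>A vertex of the independent set \<open>A\<close> becomes a leaf of a star, a vertex
  \<open>k\<close> of the clique \<open>K\<close> the path joining the centre to the at most two
  leaves in \<open>N k\<close>. The centre may have large degree, but \<open>c\<close> colours its
  branch graph, so the degree can be reduced.\<close>

lemma split_graph_in_h21:
  assumes h: "h \<ge> 3" and fin: "finite A" and verts: "verts G = A \<union> K" and disj: "A \<inter> K = {}"
    and AA: "\<And>u v. u \<in> A \<Longrightarrow> v \<in> A \<Longrightarrow> u \<noteq> v \<Longrightarrow> \<not> u \<rightarrow>\<^bsub>G\<^esub> v"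
    and KK: "\<And>u v. u \<in> K \<Longrightarrow> v \<in> K \<Longrightarrow> u \<noteq> v \<Longrightarrow> u \<rightarrow>\<^bsub>G\<^esub> v"
    and AK: "\<And>u k. u \<in> A \<Longrightarrow> k \<in> K \<Longrightarrow> u \<rightarrow>\<^bsub>G\<^esub> k \<longleftrightarrow> u \<in> N k"
    and KA: "\<And>u k. u \<in> A \<Longrightarrow> k \<in> K \<Longrightarrow> k \<rightarrow>\<^bsub>G\<^esub> u \<longleftrightarrow> u \<in> N k"
    and N: "\<And>k. k \<in> K \<Longrightarrow> N k \<subseteq> A" "\<And>k. k \<in> K \<Longrightarrow> card (N k) \<le> 2"
    and c: "\<And>u. u \<in> A \<Longrightarrow> c u < h" "\<And>k. k \<in> K \<Longrightarrow> inj_on c (N k)"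
  shows "in_h21 h G"
proof -
  obtain f :: "'a \<Rightarrow> nat" where f: "inj_on f A"
    using finite_imp_inj_to_nat_seg[OF fin] by blast
  \<comment> \<open>Leaves are numbered from 1 because 0 is the centre.\<close>
  define leaf where "leaf a = Suc (f a)" for a
  have leaf_inj: "leaf a = leaf b \<longleftrightarrow> a = b" if "a \<in> A" "b \<in> A" for a b
    using f that by (simp add: leaf_def inj_on_eq_iff)
  have leaf0: "leaf a \<noteq> 0" "0 \<noteq> leaf a" for a by (simp_all add: leaf_def)
  define V where "V = insert 0 (leaf ` A)"
  define E where "E = {(0, l) | l. l \<in> leaf ` A} \<union> {(l, 0) | l. l \<in> leaf ` A}"
  have E0: "(0, y) \<in> E \<longleftrightarrow> y \<in> leaf ` A" and E1: "y \<noteq> 0 \<Longrightarrow> (y, x) \<in> E \<longleftrightarrow> x = 0 \<and> y \<in> leaf ` A" for x y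
    using leaf0 by (auto simp: E_def)
  have "rooted_tree V E 0 (\<lambda>_. 0) id"
    by unfold_locales (use fin in \<open>auto simp: V_def E_def leaf_def\<close>)
  then have tree: "tree_on V E" unfolding tree_on_def by blast
  have "\<exists>p. tpath E p \<and> set p = insert 0 (leaf ` N k)" if k: "k \<in> K" for k
  proof -
    have finN: "finite (N k)" using N(1)[OF k] fin finite_subset by blast
    consider "card (N k) = 0" | "card (N k) = 1" | "card (N k) = 2" using N(2)[OF k] by linarith
    then show ?thesis
    proof cases
      case 1
      then have "N k = {}" using finN by simp
      then show ?thesis by (intro exI[of _ "[0]"]) (simp add: tpath_def)
    next
      case 2
      then obtain a where a: "N k = {a}" by (metis card_1_singletonE)
      then have "a \<in> A" using N(1)[OF k] by simp
      then show ?thesis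
        using a by (intro exI[of _ "[0, leaf a]"]) (simp add: tpath_def E0 leaf0)
    next
      case 3
      then obtain a b where ab: "N k = {a, b}" "a \<noteq> b" by (metis card_2_iff)
      then have "a \<in> A" "b \<in> A" using N(1)[OF k] by simp_all
      moreover have "(leaf a, 0) \<in> E" using \<open>a \<in> A\<close> by (simp add: E1 leaf0)
      ultimately show ?thesis
        using ab by (intro exI[of _ "[leaf a, 0, leaf b]"]) (auto simp: tpath_def E0 leaf0 leaf_inj)
    qed
  qed
  then obtain Q where Q: "\<And>k. k \<in> K \<Longrightarrow> tpath E (Q k)" "\<And>k. k \<in> K \<Longrightarrow> set (Q k) = insert 0 (leaf ` N k)"
    by metis
  define P where "P v = (if v \<in> A then [leaf v] else Q v)" for v
  have PA: "set (P a) = {leaf a}" "tpath E (P a)" if "a \<in> A" for a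
    using that by (simp_all add: P_def tpath_def)
  have PK: "set (P k) = insert 0 (leaf ` N k)" "tpath E (P k)" if "k \<in> K" for k
    using that Q[OF that] disj by (auto simp: P_def)
  have leaf_N: "leaf a \<in> leaf ` N k \<longleftrightarrow> a \<in> N k" if "a \<in> A" "k \<in> K" for a k
    using that N(1) leaf_inj by blast
  have rep: "represents G V E P"
    unfolding represents_def path_family_def
  proof (intro conjI ballI impI)
    show "tree_on V E" by (fact tree)
    fix u assume u: "u \<in> verts G"
    then have u': "u \<in> A \<or> u \<in> K" using verts by blast
    then show "tpath E (P u)" using PA PK by blast
    show "set (P u) \<subseteq> V"
    proof (cases "u \<in> A")
      case True
      then show ?thesis using PA(1)[OF True] by (simp add: V_def)
    next
      case False
      then have u: "u \<in> K" using u' by blast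
      show ?thesis using PK(1)[OF u] N(1)[OF u] unfolding V_def by blast
    qed
    fix v assume v: "v \<in> verts G" and uv: "u \<noteq> v"
    then have "v \<in> A \<or> v \<in> K" using verts by blast
    then consider "u \<in> A" "v \<in> A" | "u \<in> A" "v \<in> K" | "u \<in> K" "v \<in> A" | "u \<in> K" "v \<in> K"
      using u' by blast
    then show "u \<rightarrow>\<^bsub>G\<^esub> v \<longleftrightarrow> set (P u) \<inter> set (P v) \<noteq> {}"
    proof cases
      case 1
      then show ?thesis using AA[OF 1 uv] leaf_inj[OF 1] uv PA by simp
    next
      case 2
      then show ?thesis using AK[OF 2] PA(1) PK(1) leaf_N[OF 2] leaf0 by simp
    next
      case 3
      then show ?thesis using KA[OF 3(2,1)] PA(1) PK(1) leaf_N[OF 3(2,1)] leaf0 by simp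
    next
      case 4
      then show ?thesis using KK[OF 4 uv] PK(1) by simp
    qed
  qed
  \<comment> \<open>A leaf has a single branch, so any colour below \<open>h\<close> serves
    there.\<close>
  define cc where "cc x y = (if x = 0 then c (inv_into A leaf y) else 0)" for x y :: nat
  have inv: "inv_into A leaf (leaf a) = a" if "a \<in> A" for a
    using that leaf_inj by (intro inv_into_f_f) (auto simp: inj_on_def)
  have "branch_colouring h E (verts G) P cc"
    unfolding branch_colouring_def
  proof (intro conjI allI impI ballI)
    fix x y assume xy: "(x, y) \<in> E"
    show "cc x y < h"
    proof (cases "x = 0")
      case True
      then obtain a where "a \<in> A" "y = leaf a" using xy E0 by blast
      then show ?thesis using True c(1) inv by (simp add: cc_def)
    next
      case False
      then show ?thesis using h by (simp add: cc_def)
    qed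
  next
    fix v x y z
    assume v: "v \<in> verts G" and xyz: "x \<in> set (P v)" "y \<in> set (P v)" "z \<in> set (P v)"
      and E: "(x, y) \<in> E" "(x, z) \<in> E" and eq: "cc x y = cc x z"
    show "y = z"
    proof (cases "x = 0")
      case False
      then show ?thesis using E by (simp add: E1)
    next
      case True
      then have yz: "y \<in> leaf ` A" "z \<in> leaf ` A" using E E0 by simp_all
      have "v \<notin> A"
      proof
        assume "v \<in> A"
        then show False using PA(1) xyz(1) True leaf0 by simp
      qed
      then have vK: "v \<in> K" using v verts by blast
      have "y \<noteq> 0" "z \<noteq> 0" using yz leaf0 by fastforce+
      then have "y \<in> leaf ` N v" "z \<in> leaf ` N v" using xyz PK(1)[OF vK] by simp_all
      then obtain a b where ab: "a \<in> N v" "b \<in> N v" "y = leaf a" "z = leaf b" by blast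
      then have "a \<in> A" "b \<in> A" using N(1)[OF vK] by blast+
      then have "c a = c b" using eq True inv ab by (simp add: cc_def)
      then show ?thesis using inj_onD[OF c(2)[OF vK]] ab by blast
    qed
  qed
  then show ?thesis by (rule branch_colouring_in_h21[OF h rep])
qed

section \<open>The graphs built from critical graphs\<close>

locale crit_graph =
  fixes H :: "'v pair_pre_digraph" and h :: nat
  assumes graph_H: "graph (with_proj H)" and crit: "critical (Suc h) (with_proj H)" and h3: "h \<ge> 3"
begin

sublocale gH: graph "with_proj H" by (rule graph_H)

lemma H_sym: "(u, v) \<in> parcs H \<Longrightarrow> (v, u) \<in> parcs H"
  using gH.graph_symmetric[of u v] by simp

lemma H_in: "(u, v) \<in> parcs H \<Longrightarrow> u \<in> pverts H \<and> v \<in> pverts H \<and> u \<noteq> v"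
  using gH.arc_ends_distinct[of u v] by simp

lemma degree: "v \<in> pverts H \<Longrightarrow> h \<le> card (parcs H `` {v})"
  using gH.critical_min_degree[OF crit, of v] by (simp add: Image_singleton)

text \<open>Degrees are at least 3. The point is to find edges of \<open>H\<close> that avoid a
  prescribed vertex.\<close>

lemma other_nbr:
  assumes "v \<in> pverts H"
  obtains w where "(v, w) \<in> parcs H" "w \<noteq> x"
proof -
  have "\<not> parcs H `` {v} \<subseteq> {x}"
  proof
    assume "parcs H `` {v} \<subseteq> {x}"
    then have "card (parcs H `` {v}) \<le> 1" using card_mono[of "{x}"] by fastforce
    then show False using degree[OF assms] h3 by simp
  qed
  then show thesis using that by blast
qed

text \<open>All degrees are at least \<open>h \<ge> 3\<close>, so none is 1, and
  \<open>G_of H\<close> consists of original and edge vertices alone.\<close>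

lemma pendant_vertices_empty: "pendant_vertices H = {}"
  using degree h3 unfolding pendant_vertices_def out_degree_with_proj by fastforce

lemma pverts_G_of: "pverts (G_of H) = Original ` pverts H \<union> edge_vertices H"
  by (simp add: G_of_def Let_def pendant_vertices_empty)

lemma edge_vertices_eq: "edge_vertices H = {Edge {u, v} | u v. (u, v) \<in> parcs H}"
  by (simp add: edge_vertices_def)

lemma parcs_G_of: "parcs (G_of H) =
    {(x, y). x \<in> edge_vertices H \<and> y \<in> edge_vertices H \<and> x \<noteq> y} \<union>
    {(Original u, Edge {u, v}) | u v. (u, v) \<in> parcs H} \<union>
    {(Edge {u, v}, Original u) | u v. (u, v) \<in> parcs H}"
proof -
  have *: "{(Original v, Pendant v) | v. v \<in> pverts H \<and> out_degree (with_proj H) v = 1} = {}"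
    using pendant_vertices_empty unfolding pendant_vertices_def by auto
  have "incidences H = {(Original u, Edge {u, v}) | u v. (u, v) \<in> parcs H}"
    unfolding incidences_def with_proj_simps * by (rule Un_empty_right)
  then show ?thesis
    by (simp add: G_of_def Let_def pendant_vertices_empty converse_unfold) blast
qed

lemma G_of_Original_Original: "(Original u, Original v) \<notin> parcs (G_of H)"
  by (auto simp: parcs_G_of edge_vertices_eq)

lemma G_of_Edge_Edge:
  "x \<in> edge_vertices H \<Longrightarrow> y \<in> edge_vertices H \<Longrightarrow> (x, y) \<in> parcs (G_of H) \<longleftrightarrow> x \<noteq> y"
  by (auto simp: parcs_G_of edge_vertices_eq)

lemma G_of_Original_Edge:
  assumes "Edge e \<in> edge_vertices H"
  shows "(Original u, Edge e) \<in> parcs (G_of H) \<longleftrightarrow> u \<in> e"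
    "(Edge e, Original u) \<in> parcs (G_of H) \<longleftrightarrow> u \<in> e"
proof -
  obtain x y where e: "e = {x, y}" "(x, y) \<in> parcs H" using assms by (auto simp: edge_vertices_eq)
  have *: "(\<exists>v. e = {u, v} \<and> (u, v) \<in> parcs H) \<longleftrightarrow> u \<in> e"
  proof
    assume "u \<in> e"
    then have "u = x \<or> u = y" using e by simp
    then show "\<exists>v. e = {u, v} \<and> (u, v) \<in> parcs H"
      using e H_sym[OF e(2)] by (metis insert_commute)
  qed auto
  show "(Original u, Edge e) \<in> parcs (G_of H) \<longleftrightarrow> u \<in> e"
    "(Edge e, Original u) \<in> parcs (G_of H) \<longleftrightarrow> u \<in> e"
    unfolding *[symmetric] by (auto simp: parcs_G_of edge_vertices_eq)
qed

lemma G_of_arc_in: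
  "(x, y) \<in> parcs (G_of H) \<Longrightarrow> x \<in> pverts (G_of H) \<and> y \<in> pverts (G_of H) \<and> x \<noteq> y"
  using H_in unfolding parcs_G_of pverts_G_of edge_vertices_eq by blast

lemma finite_edge_vertices: "finite (edge_vertices H)"
proof (rule finite_subset)
  show "edge_vertices H \<subseteq> (\<lambda>(u, v). Edge {u, v}) ` parcs H" unfolding edge_vertices_eq by force
  show "finite ((\<lambda>(u, v). Edge {u, v}) ` parcs H)" using gH.finite_arcs by simp
qed

lemma Edge_in: "(u, v) \<in> parcs H \<Longrightarrow> Edge {u, v} \<in> edge_vertices H"
  unfolding edge_vertices_eq by blast

lemma vertices_nonempty: "pverts H \<noteq> {}"
proof
  assume "pverts H = {}"
  then have "proper_colouring (with_proj H) h (\<lambda>_. 0)"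
    using H_in by (auto simp: proper_colouring_def)
  then show False using crit gH.critical_iff by blast
qed

text \<open>The edge vertices form a clique, so their paths share a node \<open>q\<close>; the path of each original
  vertex then lies in one branch at \<open>q\<close>, and these branches colour \<open>H\<close>.\<close>

lemma G_of_not_in_h21: "\<not> in_h21 h (with_proj (G_of H))"
proof
  let ?G = "with_proj (G_of H)"
  assume "in_h21 h ?G"
  then obtain V :: "nat set" and E P where rep: "represents ?G V E P" and deg: "\<forall>x \<in> V. card (E `` {x}) \<le> h"
    unfolding in_h21_iff_represents by blast
  have tree: "tree_on V E" using rep by (simp add: represents_def path_family_def)
  have path: "tpath E (P x)" "set (P x) \<subseteq> V" if "x \<in> pverts (G_of H)" for x
    using rep that by (simp_all add: represents_def path_family_def)
  have adj: "(x, y) \<in> parcs (G_of H) \<longleftrightarrow> set (P x) \<inter> set (P y) \<noteq> {}"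
    if "x \<in> pverts (G_of H)" "y \<in> pverts (G_of H)" "x \<noteq> y" for x y
    using rep that by (simp add: represents_def)
  have EV: "x \<in> pverts (G_of H)" if "x \<in> edge_vertices H" for x
    using that by (simp add: pverts_G_of)
  have OV: "Original u \<in> pverts (G_of H)" if "u \<in> pverts H" for u
    using that by (simp add: pverts_G_of)
  have meet: "set (P (Original u)) \<inter> set (P (Edge e)) \<noteq> {} \<longleftrightarrow> u \<in> e"
    if "u \<in> pverts H" "Edge e \<in> edge_vertices H" for u e
    using adj[OF OV[OF that(1)] EV[OF that(2)]] G_of_Original_Edge(1)[OF that(2)] by simp
  have ne: "edge_vertices H \<noteq> {}"
    using vertices_nonempty other_nbr Edge_in by (metis empty_iff ex_in_conv)
  obtain r0 par0 rk0 where "rooted_tree V E r0 par0 rk0" using tree by (auto simp: tree_on_def)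
  then interpret T0: rooted_tree V E r0 par0 rk0 .
  have "\<exists>q. \<forall>x \<in> edge_vertices H. q \<in> set (P x)"
  proof (rule T0.helly)
    fix x y assume xy: "x \<in> edge_vertices H" "y \<in> edge_vertices H"
    show "tpath E (P x)" using path(1) EV xy by blast
    show "set (P x) \<inter> set (P y) \<noteq> {}"
    proof (cases "x = y")
      case True
      then show ?thesis using path(1)[OF EV[OF xy(1)]] by (simp add: tpath_def)
    next
      case False
      then show ?thesis using adj[OF EV[OF xy(1)] EV[OF xy(2)]] G_of_Edge_Edge[OF xy] by blast
    qed
  qed (use finite_edge_vertices ne in auto)
  then obtain q where q: "\<And>x. x \<in> edge_vertices H \<Longrightarrow> q \<in> set (P x)" by blast
  have qV: "q \<in> V" using ne q path(2) EV by blast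
  obtain par rk where "rooted_tree V E q par rk" using tree_on_reroot[OF tree qV] by blast
  then interpret T: rooted_tree V E q par rk .
  have closed: "T.par_closed (set (P x))" if "x \<in> edge_vertices H" for x
    using T.path_par_closed path(1) EV q that by blast
  \<comment> \<open>Some edge of \<open>H\<close> avoids \<open>u\<close>; its path contains
    \<open>q\<close> and is disjoint from the path of \<open>u\<close>.\<close>
  have avoid: "q \<notin> set (P (Original u))" if u: "u \<in> pverts H" for u
  proof -
    obtain w where w: "(u, w) \<in> parcs H" using other_nbr[OF u] by blast
    then obtain w' where w': "(w, w') \<in> parcs H" "w' \<noteq> u" using other_nbr[of w] H_in by blast
    then have "u \<notin> {w, w'}" using H_in[OF w] by blast
    then show ?thesis using meet[OF u Edge_in[OF w'(1)]] q[OF Edge_in[OF w'(1)]] by blast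
  qed
  define br where "br u = T.top (hd (P (Original u)))" for u
  have br: "T.top x = br u" if "u \<in> pverts H" "x \<in> set (P (Original u))" for u x
    using T.path_avoiding_root[OF path(1)[OF OV[OF that(1)]] avoid[OF that(1)] that(2)]
      path(1)[OF OV[OF that(1)]] unfolding br_def by (simp add: tpath_def)
  have br_in: "br u \<in> E `` {q}" if u: "u \<in> pverts H" for u
  proof -
    have "hd (P (Original u)) \<in> set (P (Original u))"
      using path(1)[OF OV[OF u]] by (simp add: tpath_def)
    then have "hd (P (Original u)) \<in> V" "hd (P (Original u)) \<noteq> q"
      using path(2)[OF OV[OF u]] avoid[OF u] by (auto dest: subsetD)
    then show ?thesis using T.top_in unfolding br_def by blast
  qed
  have proper: "br u \<noteq> br w" if uw: "(u, w) \<in> parcs H" for u w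
  proof
    assume eq: "br u = br w"
    have u: "u \<in> pverts H" and w: "w \<in> pverts H" and "u \<noteq> w" using H_in[OF uw] by simp_all
    \<comment> \<open>Edge paths contain the root \<open>q\<close> and are thus closed under
      parents. So the topmost node \<open>s\<close> of the path of \<open>u\<close> lies on every
      edge path that meets this path, and likewise \<open>t\<close> for \<open>w\<close>.\<close>
    obtain s where s: "s \<in> set (P (Original u))"
      "\<And>S. T.par_closed S \<Longrightarrow> set (P (Original u)) \<inter> S \<noteq> {} \<Longrightarrow> s \<in> S"
      using T.path_apex_closed[OF path(1)[OF OV[OF u]]] by blast
    obtain t where t: "t \<in> set (P (Original w))"
      "\<And>S. T.par_closed S \<Longrightarrow> set (P (Original w)) \<inter> S \<noteq> {} \<Longrightarrow> t \<in> S"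
      using T.path_apex_closed[OF path(1)[OF OV[OF w]]] by blast
    have X: "Edge {u, w} \<in> edge_vertices H" by (rule Edge_in[OF uw])
    have sX: "s \<in> set (P (Edge {u, w}))" and tX: "t \<in> set (P (Edge {u, w}))"
      using s(2)[OF closed[OF X]] t(2)[OF closed[OF X]] meet[OF u X] meet[OF w X] by simp_all
    have top: "T.top s = T.top t" using br[OF u s(1)] br[OF w t(1)] eq by simp
    have sq: "s \<noteq> q" "t \<noteq> q" using avoid[OF u] avoid[OF w] s(1) t(1) by auto
    \<comment> \<open>Here \<open>y\<close> is an ancestor of \<open>x\<close>. Every edge path at
      \<open>a\<close> contains \<open>x\<close>, hence \<open>y\<close>, and so meets the path of
      \<open>b\<close>; an edge at \<open>a\<close> that avoids \<open>b\<close> contradicts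
      this.\<close>
    have one: False if "\<forall>S. T.par_closed S \<longrightarrow> x \<in> S \<longrightarrow> y \<in> S"
      and a: "a \<in> pverts H" and b: "b \<in> pverts H" and "a \<noteq> b"
      and x: "\<And>S. T.par_closed S \<Longrightarrow> set (P (Original a)) \<inter> S \<noteq> {} \<Longrightarrow> x \<in> S"
      and y: "y \<in> set (P (Original b))" for x y a b
    proof -
      obtain a' where a': "(a, a') \<in> parcs H" "a' \<noteq> b" using other_nbr[OF a] by blast
      have Y: "Edge {a, a'} \<in> edge_vertices H" by (rule Edge_in[OF a'(1)])
      have "x \<in> set (P (Edge {a, a'}))" using x[OF closed[OF Y]] meet[OF a Y] by simp
      then have "y \<in> set (P (Edge {a, a'}))" using that(1) closed[OF Y] by blast
      then have "b \<in> {a, a'}" using meet[OF b Y] y by blast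
      then show False using \<open>a \<noteq> b\<close> a'(2) by simp
    qed
    from T.same_branch_comparable[OF path(1)[OF EV[OF X]] q[OF X] sX tX sq top]
    show False
    proof
      assume "\<forall>S. T.par_closed S \<longrightarrow> s \<in> S \<longrightarrow> t \<in> S"
      then show False by (rule one[OF _ u w \<open>u \<noteq> w\<close> s(2) t(1)])
    next
      assume "\<forall>S. T.par_closed S \<longrightarrow> t \<in> S \<longrightarrow> s \<in> S"
      then show False by (rule one[OF _ w u \<open>u \<noteq> w\<close>[symmetric] t(2) s(1)])
    qed
  qed
  \<comment> \<open>There are at most \<open>h\<close> branches at \<open>q\<close>, so numbering
    them below \<open>h\<close> turns \<open>br\<close> into an \<open>h\<close>-colouring of
    \<open>H\<close>.\<close>
  obtain f :: "nat \<Rightarrow> nat" where f: "inj_on f (E `` {q})" "f ` (E `` {q}) \<subseteq> {..<h}"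
    using card_le_inj[OF T.finite_nbrs, of "{..<h}" q] deg qV by auto
  have "proper_colouring (with_proj H) h (f \<circ> br)"
    unfolding proper_colouring_def
  proof (intro conjI ballI allI impI)
    fix u assume "u \<in> verts (with_proj H)"
    then have "f (br u) \<in> {..<h}" using br_in f(2) by auto
    then show "(f \<circ> br) u < h" by simp
  next
    fix u w assume "u \<rightarrow>\<^bsub>with_proj H\<^esub> w"
    then have uw: "(u, w) \<in> parcs H" by simp
    then show "(f \<circ> br) u \<noteq> (f \<circ> br) w"
      using proper[OF uw] br_in H_in[OF uw] f(1) by (simp add: inj_on_eq_iff)
  qed
  then show False using crit gH.critical_iff by blast
qed

text \<open>Criticality supplies the colouring of the star: that of \<open>H\<close> minus a vertex
  if an original vertex is deleted, that of \<open>H\<close> minus an edge if an edge vertex is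
  deleted. \<open>main\<close> covers both, with \<open>B\<close> the vertices of \<open>H\<close>
  whose originals remain and \<open>K\<close> the remaining edge vertices.\<close>

lemma G_of_del_vert_in_h21:
  assumes v: "v \<in> pverts (G_of H)"
  shows "in_h21 h (pre_digraph.del_vert (with_proj (G_of H)) v)"
proof -
  have card2: "card ({x, y} \<inter> B) \<le> 2" for x y :: 'v and B
    using card_mono[of "{x, y}" "{x, y} \<inter> B"] card_insert_le_m1[of 2 "{y}" x] by simp
  have main: "in_h21 h (pre_digraph.del_vert (with_proj (G_of H)) v)"
    if verts: "pverts (G_of H) - {v} = Original ` B \<union> K" and B: "B \<subseteq> pverts H"
      and K: "K \<subseteq> edge_vertices H" and vB: "v \<notin> Original ` B \<union> K"
      and c: "\<And>u. u \<in> B \<Longrightarrow> c u < h"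
      and cK: "\<And>u w. Edge {u, w} \<in> K \<Longrightarrow> (u, w) \<in> parcs H \<Longrightarrow> u \<in> B \<Longrightarrow> w \<in> B \<Longrightarrow> c u \<noteq> c w"
    for B K and c :: "'v \<Rightarrow> nat"
  proof -
    \<comment> \<open>Intersecting with \<open>B\<close> matters for edge vertices at a deleted
      original vertex: only one of their two ends remains.\<close>
    define N where "N k = Original ` ({u. \<exists>e. k = Edge e \<and> u \<in> e} \<inter> B)" for k :: "'v gvertex"
    define c' where "c' x = (case x of Original u \<Rightarrow> c u | _ \<Rightarrow> 0)" for x :: "'v gvertex"
    have Kform: "\<exists>x y. k = Edge {x, y} \<and> (x, y) \<in> parcs H" if "k \<in> K" for k
      using that K unfolding edge_vertices_eq by blast
    have arcs: "x \<rightarrow>\<^bsub>pre_digraph.del_vert (with_proj (G_of H)) v\<^esub> y \<longleftrightarrow> (x, y) \<in> parcs (G_of H)"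
      if "x \<in> Original ` B \<union> K" "y \<in> Original ` B \<union> K" for x y
    proof -
      have "x \<noteq> v" "y \<noteq> v" using that vB by metis+
      then show ?thesis by (simp add: arcs_ends_del_vert)
    qed
    show ?thesis
    proof (rule split_graph_in_h21[where A = "Original ` B" and K = K and N = N and c = c', OF h3])
      show "finite (Original ` B)"
        using B gH.finite_verts finite_subset by auto
      show "verts (pre_digraph.del_vert (with_proj (G_of H)) v) = Original ` B \<union> K"
        using verts by (simp add: pre_digraph.verts_del_vert)
      show "Original ` B \<inter> K = {}" using Kform by fastforce
    next
      fix u w assume "u \<in> Original ` B" "w \<in> Original ` B" "u \<noteq> w"
      then show "\<not> u \<rightarrow>\<^bsub>pre_digraph.del_vert (with_proj (G_of H)) v\<^esub> w"
        using arcs[of u w] G_of_Original_Original by auto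
    next
      fix u w assume "u \<in> K" "w \<in> K" "u \<noteq> w"
      then show "u \<rightarrow>\<^bsub>pre_digraph.del_vert (with_proj (G_of H)) v\<^esub> w"
        using arcs[of u w] G_of_Edge_Edge[of u w] K by blast
    next
      fix x k assume x: "x \<in> Original ` B" and k: "k \<in> K"
      obtain u where u: "x = Original u" "u \<in> B" using x by blast
      obtain e where e: "k = Edge e" "Edge e \<in> edge_vertices H" using Kform[OF k] k K by blast
      have N: "x \<in> N k \<longleftrightarrow> u \<in> e" using u e by (auto simp: N_def)
      show "x \<rightarrow>\<^bsub>pre_digraph.del_vert (with_proj (G_of H)) v\<^esub> k \<longleftrightarrow> x \<in> N k"
        using arcs[of x k] x k G_of_Original_Edge(1)[OF e(2)] N u e by simp
      show "k \<rightarrow>\<^bsub>pre_digraph.del_vert (with_proj (G_of H)) v\<^esub> x \<longleftrightarrow> x \<in> N k"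
        using arcs[of k x] x k G_of_Original_Edge(2)[OF e(2)] N u e by simp
    next
      fix k assume k: "k \<in> K"
      show "N k \<subseteq> Original ` B" by (auto simp: N_def)
      obtain x y where xy: "k = Edge {x, y}" "(x, y) \<in> parcs H" using Kform[OF k] by blast
      have Nk: "N k = Original ` ({x, y} \<inter> B)"
        unfolding N_def xy(1) by (rule arg_cong[of _ _ "(`) Original"]) auto
      have "card (N k) \<le> card ({x, y} \<inter> B)" unfolding Nk by (rule card_image_le) simp
      then show "card (N k) \<le> 2" using card2[of x y B] by simp
      show "inj_on c' (N k)"
      proof (rule inj_onI)
        fix a b assume "a \<in> N k" "b \<in> N k" and eq: "c' a = c' b"
        then obtain a' b' where ab: "a = Original a'" "b = Original b'" "a' \<in> {x, y} \<inter> B" "b' \<in> {x, y} \<inter> B"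
          unfolding Nk by blast
        have "c a' = c b'" using eq ab by (simp add: c'_def)
        moreover have "c x \<noteq> c y" if "x \<in> B" "y \<in> B"
          using cK[of x y] k xy that by blast
        ultimately have "a' = b'" using ab(3,4) by auto
        then show "a = b" using ab by simp
      qed
    next
      fix x assume "x \<in> Original ` B"
      then show "c' x < h" using c by (auto simp: c'_def)
    qed
  qed
  have EV_ne: "Original w \<notin> edge_vertices H" for w by (auto simp: edge_vertices_eq)
  from v consider w where "v = Original w" "w \<in> pverts H" | "v \<in> edge_vertices H"
    unfolding pverts_G_of by blast
  then show ?thesis
  proof cases
    case 1
    have "\<exists>c. proper_colouring (pre_digraph.del_vert (with_proj H) w) h c"
      using crit[unfolded gH.critical_iff] 1 by simp
    then obtain c where "proper_colouring (pre_digraph.del_vert (with_proj H) w) h c" by blast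
    then have c: "\<And>u. u \<in> pverts H - {w} \<Longrightarrow> c u < h"
      "\<And>x y. (x, y) \<in> parcs H \<Longrightarrow> x \<noteq> w \<Longrightarrow> y \<noteq> w \<Longrightarrow> c x \<noteq> c y"
      unfolding proper_colouring_del_vert by auto
    show ?thesis
      by (rule main[of "pverts H - {w}" "edge_vertices H" c])
        (use 1 c EV_ne in \<open>auto simp: pverts_G_of\<close>)
  next
    case 2
    then obtain x y where xy: "v = Edge {x, y}" "(x, y) \<in> parcs H"
      by (auto simp: edge_vertices_eq)
    have "\<exists>c. proper_colouring (del_edge (with_proj H) x y) h c"
      using crit[unfolded gH.critical_iff] xy(2) by simp
    then obtain c where "proper_colouring (del_edge (with_proj H) x y) h c" by blast
    then have c: "\<And>u. u \<in> pverts H \<Longrightarrow> c u < h"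
      "\<And>u w. (u, w) \<in> parcs H \<Longrightarrow> (u, w) \<notin> {(x, y), (y, x)} \<Longrightarrow> c u \<noteq> c w"
      unfolding proper_colouring_def arcs_ends_del_edge verts_del_edge by auto
    show ?thesis
    proof (rule main[of "pverts H" "edge_vertices H - {v}" c])
      fix u w assume "Edge {u, w} \<in> edge_vertices H - {v}" and uw: "(u, w) \<in> parcs H"
      then have "{u, w} \<noteq> {x, y}" using xy by simp
      then have "(u, w) \<notin> {(x, y), (y, x)}" by auto
      then show "c u \<noteq> c w" using c(2)[OF uw] by blast
    qed (use 2 c(1) EV_ne xy in \<open>auto simp: pverts_G_of\<close>)
  qed
qed

lemma G_of_minimal_non_h21: "minimal_non_h21 h (with_proj (G_of H))"
  using G_of_not_in_h21 G_of_del_vert_in_h21 by (simp add: minimal_non_h21_def)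

end

section \<open>Minimal graphs outside the class\<close>

lemma digraph_iso_embeds:
  assumes "digraph_iso G G'"
  obtains f where "embeds f G G'" "f ` verts G = verts G'"
    "embeds (the_inv_into (verts G) f) G' G"
proof -
  obtain hom where hom: "pre_digraph.digraph_isomorphism G hom" and G': "G' = app_iso hom G"
    using assms unfolding digraph_iso_def by blast
  interpret wf_digraph G using hom by (simp add: pre_digraph.digraph_isomorphism_def)
  let ?f = "iso_verts hom"
  have inj: "inj_on ?f (verts G)" using hom by (simp add: pre_digraph.digraph_isomorphism_def)
  have verts: "?f ` verts G = verts G'" by (simp add: G')
  have arcs: "arcs_ends G' = (\<lambda>(u, v). (?f u, ?f v)) ` arcs_ends G"
    unfolding G' by (rule arcs_ends_app_iso_eq[OF hom])
  have adj: "u \<rightarrow>\<^bsub>G\<^esub> v \<longleftrightarrow> ?f u \<rightarrow>\<^bsub>G'\<^esub> ?f v" if "u \<in> verts G" "v \<in> verts G" for u v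
  proof
    assume "u \<rightarrow>\<^bsub>G\<^esub> v"
    then show "?f u \<rightarrow>\<^bsub>G'\<^esub> ?f v" unfolding arcs by (rule rev_image_eqI) simp
  next
    assume "?f u \<rightarrow>\<^bsub>G'\<^esub> ?f v"
    then obtain x y where xy: "x \<rightarrow>\<^bsub>G\<^esub> y" "?f u = ?f x" "?f v = ?f y" unfolding arcs by auto
    then have "u = x" "v = y" using inj_onD[OF inj] that adj_in_verts[OF xy(1)] by blast+
    then show "u \<rightarrow>\<^bsub>G\<^esub> v" using xy by simp
  qed
  let ?g = "the_inv_into (verts G) ?f"
  have g: "?g x \<in> verts G" "?f (?g x) = x" if "x \<in> verts G'" for x
  proof -
    have "x \<in> ?f ` verts G" using that verts by simp
    then show "?g x \<in> verts G" "?f (?g x) = x"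
      using the_inv_into_into[OF inj _ order_refl] f_the_inv_into_f[OF inj] by blast+
  qed
  have "embeds ?f G G'"
    unfolding embeds_def using inj verts adj by simp
  moreover have "embeds ?g G' G"
    unfolding embeds_def
  proof (intro conjI ballI impI)
    show "inj_on ?g (verts G')" using inj_on_the_inv_into[OF inj] unfolding verts .
    show "?g ` verts G' \<subseteq> verts G" using g(1) by blast
    fix u v assume "u \<in> verts G'" "v \<in> verts G'"
    then show "u \<rightarrow>\<^bsub>G'\<^esub> v \<longleftrightarrow> ?g u \<rightarrow>\<^bsub>G\<^esub> ?g v" using adj[OF g(1) g(1)] g(2) by simp
  qed
  ultimately show thesis using that verts by blast
qed

lemma embeds_del_vert:
  assumes "embeds f G G'" "v \<in> verts G"
  shows "embeds f (pre_digraph.del_vert G v) (pre_digraph.del_vert G' (f v))"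
proof -
  have ne: "f u \<noteq> f v" if "u \<in> verts G" "u \<noteq> v" for u
    using assms that unfolding embeds_def by (metis inj_onD)
  show ?thesis
    using assms(1) ne unfolding embeds_def pre_digraph.verts_del_vert arcs_ends_del_vert
    by (auto intro: inj_on_diff)
qed

lemma embeds_into_del_vert:
  assumes "embeds f G' G" "v \<notin> f ` verts G'"
  shows "embeds f G' (pre_digraph.del_vert G v)"
  using assms unfolding embeds_def pre_digraph.verts_del_vert arcs_ends_del_vert by auto

lemma minimal_non_h21_iso:
  assumes "digraph_iso G G'" "minimal_non_h21 h G'"
  shows "minimal_non_h21 h G"
proof -
  obtain f where f: "embeds f G G'" "f ` verts G = verts G'" "embeds (the_inv_into (verts G) f) G' G"
    by (rule digraph_iso_embeds[OF assms(1)])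
  have "\<not> in_h21 h G" using embeds_in_h21[OF f(3)] assms(2) by (auto simp: minimal_non_h21_def)
  moreover have "in_h21 h (pre_digraph.del_vert G v)" if v: "v \<in> verts G" for v
  proof -
    have "f v \<in> verts G'" using f(2) v by blast
    then have "in_h21 h (pre_digraph.del_vert G' (f v))"
      using assms(2) by (simp add: minimal_non_h21_def)
    then show ?thesis by (rule embeds_in_h21[OF embeds_del_vert[OF f(1) v]])
  qed
  ultimately show ?thesis by (simp add: minimal_non_h21_def)
qed

text \<open>An arc of \<open>G\<close> is sent to the pair of images of its ends under the inverse
  of \<open>f\<close>, which is injective since \<open>G\<close> has no parallel arcs. At equal
  ends, where \<open>embeds\<close> says nothing, neither graph has an arc.\<close>

lemma bijective_embedding_digraph_iso:
  fixes G' :: "'c pair_pre_digraph"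
  assumes "graph G" and emb: "embeds f (with_proj G') G" and onto: "f ` pverts G' = verts G"
    and G': "\<And>x y. (x, y) \<in> parcs G' \<Longrightarrow> x \<in> pverts G' \<and> y \<in> pverts G' \<and> x \<noteq> y"
  shows "digraph_iso G (with_proj G')"
proof -
  interpret graph G by fact
  have inj: "inj_on f (pverts G')" using emb by (simp add: embeds_def)
  define g where "g = the_inv_into (pverts G') f"
  have gf: "g (f x) = x" if "x \<in> pverts G'" for x
    unfolding g_def using inj that by (rule the_inv_into_f_f)
  have g: "g y \<in> pverts G'" "f (g y) = y" if "y \<in> verts G" for y
  proof -
    have "y \<in> f ` pverts G'" using that onto by simp
    then obtain x where "x \<in> pverts G'" "y = f x" by blast
    then show "g y \<in> pverts G'" "f (g y) = y" by (simp_all add: gf)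
  qed
  have arc: "(x, y) \<in> parcs G' \<longleftrightarrow> f x \<rightarrow>\<^bsub>G\<^esub> f y" if "x \<in> pverts G'" "y \<in> pverts G'" for x y
  proof (cases "x = y")
    case True
    then show ?thesis using G'[of x y] adj_not_same[of "f x"] by auto
  next
    case False
    then show ?thesis using emb that by (simp add: embeds_def)
  qed
  define hom where "hom = \<lparr>iso_verts = g, iso_arcs = \<lambda>a. (g (tail G a), g (head G a)),
    iso_head = snd, iso_tail = fst\<rparr>"
  have g_inj: "inj_on g (verts G)" by (rule inj_on_inverseI) (rule g(2))
  have "inj_on (iso_arcs hom) (arcs G)"
  proof (rule inj_onI)
    fix a b assume ab: "a \<in> arcs G" "b \<in> arcs G" and "iso_arcs hom a = iso_arcs hom b"
    then have "g (tail G a) = g (tail G b)" "g (head G a) = g (head G b)" by (simp_all add: hom_def)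
    then have "arc_to_ends G a = arc_to_ends G b"
      using inj_onD[OF g_inj] ab by (simp add: arc_to_ends_def)
    then show "a = b" using no_multi_arcs ab by blast
  qed
  then have iso: "digraph_isomorphism hom"
    unfolding digraph_isomorphism_def using wf_digraph g_inj by (simp add: hom_def)
  have "iso_arcs hom ` arcs G = parcs G'"
  proof (rule set_eqI, rule iffI)
    fix e assume "e \<in> iso_arcs hom ` arcs G"
    then obtain a where a: "a \<in> arcs G" "e = (g (tail G a), g (head G a))" by (auto simp: hom_def)
    have "tail G a \<rightarrow>\<^bsub>G\<^esub> head G a" using a(1) by (auto simp: arcs_ends_conv)
    then show "e \<in> parcs G'" using a arc g by simp
  next
    fix e assume e: "e \<in> parcs G'"
    obtain x y where xy: "e = (x, y)" by (cases e)
    then have v: "x \<in> pverts G'" "y \<in> pverts G'" using G' e by blast+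
    then obtain a where "a \<in> arcs G" "tail G a = f x" "head G a = f y"
      using arc e xy by (auto elim: reachableE)
    then show "e \<in> iso_arcs hom ` arcs G"
      using gf v xy by (intro image_eqI[of _ _ a]) (simp_all add: hom_def)
  qed
  moreover have "g ` verts G = pverts G'" using g(1) gf onto by force
  ultimately have "with_proj G' = app_iso hom G"
    by (simp add: with_proj_def app_iso_def hom_def)
  then show ?thesis using iso unfolding digraph_iso_def by blast
qed

lemma embeds_G_of_uncolourable:
  fixes G :: "('a, 'b) pre_digraph"
  assumes "graph G" "VPT G" "\<not> in_h21 h G" "h \<ge> 3"
  shows "\<exists>(H :: nat pair_pre_digraph) \<psi>. graph (with_proj H) \<and> connected (with_proj H) \<and>
    critical (Suc h) (with_proj H) \<and> embeds \<psi> (with_proj (G_of (with_proj H))) G"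
proof -
  obtain V :: "nat set" and E P q where rep: "represents G V E P" and qV: "q \<in> V"
    and priv: "\<forall>a. (q, a) \<in> E \<longrightarrow> (\<exists>v \<in> verts G. a \<in> set (P v) \<and> q \<notin> set (P v))"
    and uncol: "\<forall>c :: nat \<Rightarrow> nat. (\<forall>a. (q, a) \<in> E \<longrightarrow> c a < h) \<longrightarrow> (\<exists>v \<in> verts G. \<exists>a b.
      {q, a, b} \<subseteq> set (P v) \<and> (q, a) \<in> E \<and> (q, b) \<in> E \<and> a \<noteq> b \<and> c a = c b)"
    using uncolourable_branches[OF assms(2-4)] by (elim exE conjE)
  have tree: "tree_on V E" using rep by (simp add: represents_def path_family_def)
  obtain par rk where "rooted_tree V E q par rk" using tree_on_reroot[OF tree qV] by blast
  then interpret T: rooted_tree V E q par rk .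
  have path: "tpath E (P v)" "set (P v) \<subseteq> V" if "v \<in> verts G" for v
    using rep that by (simp_all add: represents_def path_family_def)
  have adj: "u \<rightarrow>\<^bsub>G\<^esub> v \<longleftrightarrow> set (P u) \<inter> set (P v) \<noteq> {}"
    if "u \<in> verts G" "v \<in> verts G" "u \<noteq> v" for u v
    using rep that unfolding represents_def by blast
  define F where "F = {(a, b). (q, a) \<in> E \<and> (q, b) \<in> E \<and> a \<noteq> b \<and> (\<exists>v \<in> verts G. {q, a, b} \<subseteq> set (P v))}"
  have "\<nexists>c. proper_colouring (with_proj \<lparr>pverts = E `` {q}, parcs = F\<rparr>) h c"
  proof
    assume "\<exists>c. proper_colouring (with_proj \<lparr>pverts = E `` {q}, parcs = F\<rparr>) h c"
    then obtain c where c: "\<And>a. (q, a) \<in> E \<Longrightarrow> c a < h" "\<And>a b. (a, b) \<in> F \<Longrightarrow> c a \<noteq> c b"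
      unfolding proper_colouring_def by auto
    obtain v a b where "v \<in> verts G" "{q, a, b} \<subseteq> set (P v)" "(q, a) \<in> E" "(q, b) \<in> E" "a \<noteq> b" "c a = c b"
      using uncol[rule_format, of c] c(1) by blast
    then have "(a, b) \<in> F" unfolding F_def by blast
    then show False using c(2) \<open>c a = c b\<close> by blast
  qed
  moreover have "F \<subseteq> E `` {q} \<times> E `` {q}" by (auto simp: F_def)
  moreover have "sym F" unfolding F_def sym_def by blast
  moreover have "irrefl F" unfolding F_def irrefl_def by blast
  ultimately obtain H :: "nat pair_pre_digraph" where H: "graph (with_proj H)"
    "connected (with_proj H)" "critical (Suc h) (with_proj H)" "pverts H \<subseteq> E `` {q}" "parcs H \<subseteq> F"
    using ex_critical_subgraph[OF T.finite_nbrs] by metis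
  then interpret H: crit_graph H h
    using assms(4) by (intro crit_graph.intro) simp_all
  obtain p where p: "\<And>a. (q, a) \<in> E \<Longrightarrow> p a \<in> verts G \<and> a \<in> set (P (p a)) \<and> q \<notin> set (P (p a))"
    using priv by metis
  have "\<exists>v \<in> verts G. insert q e \<subseteq> set (P v)" if "Edge e \<in> edge_vertices H" for e
  proof -
    obtain a b where ab: "e = {a, b}" "(a, b) \<in> parcs H"
      using \<open>Edge e \<in> edge_vertices H\<close> unfolding H.edge_vertices_eq by blast
    then have "(a, b) \<in> F" using H(5) by blast
    then show ?thesis unfolding F_def ab(1) by blast
  qed
  then obtain x where x: "\<And>e. Edge e \<in> edge_vertices H \<Longrightarrow> x e \<in> verts G \<and> insert q e \<subseteq> set (P (x e))"
    by metis
  \<comment> \<open>The value at \<open>Pendant\<close> is a filler: \<open>G_of H\<close> has no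
    pendant vertices.\<close>
  define \<psi> where "\<psi> w = (case w of Original a \<Rightarrow> p a | Edge e \<Rightarrow> x e | Pendant a \<Rightarrow> p a)" for w
  have nbr: "(q, a) \<in> E" if "a \<in> pverts H" for a using H(4) that by blast
  have edge: "\<exists>a b. e = {a, b} \<and> a \<noteq> b \<and> (q, a) \<in> E \<and> (q, b) \<in> E"
    if e: "Edge e \<in> edge_vertices H" for e
  proof -
    obtain a b where ab: "e = {a, b}" "(a, b) \<in> parcs H"
      using e unfolding H.edge_vertices_eq by blast
    then have "(a, b) \<in> F" using H(5) by blast
    then show ?thesis using ab(1) unfolding F_def by blast
  qed
  \<comment> \<open>A path through \<open>q\<close> contains at most two neighbours of
    \<open>q\<close>, so the path chosen for \<open>e\<close> contains none besides the ends of
    \<open>e\<close>. This makes the copy induced and lets \<open>e\<close> be recovered from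
    \<open>x e\<close>.\<close>
  have only: "c \<in> e" if e: "Edge e \<in> edge_vertices H" and c: "(q, c) \<in> E" "c \<in> set (P (x e))" for e c
  proof -
    obtain a b where ab: "e = {a, b}" "a \<noteq> b" "(q, a) \<in> E" "(q, b) \<in> E" using edge[OF e] by blast
    have "{a, b, c} \<subseteq> set (P (x e))" "q \<in> set (P (x e))" using x[OF e] c ab(1) by auto
    then show ?thesis
      using T.path_root_nbrs[OF path(1), of "x e" a b c] x[OF e] ab c by blast
  qed
  \<comment> \<open>The path \<open>P (p a)\<close> avoids \<open>q\<close>, hence stays in the
    branch of \<open>a\<close>.\<close>
  have OO: "set (P (p a)) \<inter> set (P (p b)) = {}" "p a \<noteq> p b"
    if "a \<in> pverts H" "b \<in> pverts H" "a \<noteq> b" for a b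
  proof -
    have a: "p a \<in> verts G" "a \<in> set (P (p a))" "q \<notin> set (P (p a))"
      and b: "p b \<in> verts G" "b \<in> set (P (p b))" "q \<notin> set (P (p b))"
      using p[OF nbr] that by blast+
    have "T.top z = a" if "z \<in> set (P (p a))" for z
      using T.path_avoiding_root[OF path(1)[OF a(1)] a(3) that a(2)] T.top_nbr[OF nbr] \<open>a \<in> pverts H\<close> by simp
    moreover have "T.top z = b" if "z \<in> set (P (p b))" for z
      using T.path_avoiding_root[OF path(1)[OF b(1)] b(3) that b(2)] T.top_nbr[OF nbr] \<open>b \<in> pverts H\<close> by simp
    ultimately show "set (P (p a)) \<inter> set (P (p b)) = {}" using \<open>a \<noteq> b\<close> by blast
    then show "p a \<noteq> p b" using a(2) by force
  qed
  have OE: "set (P (p a)) \<inter> set (P (x e)) \<noteq> {} \<longleftrightarrow> a \<in> e" "p a \<noteq> x e"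
    if a: "a \<in> pverts H" and e: "Edge e \<in> edge_vertices H" for a e
  proof -
    have pa: "p a \<in> verts G" "a \<in> set (P (p a))" "q \<notin> set (P (p a))" using p[OF nbr[OF a]] by blast+
    have xe: "x e \<in> verts G" "q \<in> set (P (x e))" "e \<subseteq> set (P (x e))" using x[OF e] by blast+
    show "p a \<noteq> x e" using pa(3) xe(2) by metis
    show "set (P (p a)) \<inter> set (P (x e)) \<noteq> {} \<longleftrightarrow> a \<in> e"
    proof
      assume "set (P (p a)) \<inter> set (P (x e)) \<noteq> {}"
      then obtain z where z: "z \<in> set (P (p a))" "z \<in> set (P (x e))" by blast
      then have zq: "z \<noteq> q" using pa(3) by blast
      have "T.top z = a"
        using T.path_avoiding_root[OF path(1)[OF pa(1)] pa(3) z(1) pa(2)] T.top_nbr[OF nbr[OF a]] by simp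
      \<comment> \<open>An edge path contains \<open>q\<close> and can enter the branch of
        \<open>a\<close> only through \<open>a\<close> itself.\<close>
      then have "a \<in> set (P (x e))" using T.gate[OF path(1)[OF xe(1)] xe(2) z(2) zq] by simp
      then show "a \<in> e" by (rule only[OF e nbr[OF a]])
    next
      assume "a \<in> e"
      then show "set (P (p a)) \<inter> set (P (x e)) \<noteq> {}" using pa(2) xe(3) by blast
    qed
  qed
  have EE: "set (P (x e)) \<inter> set (P (x e')) \<noteq> {}" "x e = x e' \<Longrightarrow> e = e'"
    if e: "Edge e \<in> edge_vertices H" "Edge e' \<in> edge_vertices H" for e e'
  proof -
    show "set (P (x e)) \<inter> set (P (x e')) \<noteq> {}" using x[OF e(1)] x[OF e(2)] by blast
    assume eq: "x e = x e'"
    have "e \<subseteq> e'"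
    proof
      fix c assume "c \<in> e"
      moreover have "(q, c) \<in> E" using edge[OF e(1)] \<open>c \<in> e\<close> by blast
      ultimately show "c \<in> e'" using only[OF e(2)] x[OF e(1)] eq by auto
    qed
    moreover have "e' \<subseteq> e"
    proof
      fix c assume "c \<in> e'"
      moreover have "(q, c) \<in> E" using edge[OF e(2)] \<open>c \<in> e'\<close> by blast
      ultimately show "c \<in> e" using only[OF e(1)] x[OF e(2)] eq by auto
    qed
    ultimately show "e = e'" by blast
  qed
  have cases: "(\<exists>a \<in> pverts H. w = Original a) \<or> (\<exists>e. w = Edge e \<and> Edge e \<in> edge_vertices H)"
    if "w \<in> pverts (G_of H)" for w
    using that unfolding H.pverts_G_of H.edge_vertices_eq by blast
  have \<psi>_in: "\<psi> w \<in> verts G" if "w \<in> pverts (G_of H)" for w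
    using cases[OF that]
  proof (elim disjE bexE exE conjE)
    fix a assume "a \<in> pverts H" "w = Original a"
    then show ?thesis using p[OF nbr] by (simp add: \<psi>_def)
  next
    fix e assume "w = Edge e" "Edge e \<in> edge_vertices H"
    then show ?thesis using x by (simp add: \<psi>_def)
  qed
  have main: "\<psi> u \<noteq> \<psi> v \<and> ((u, v) \<in> parcs (G_of H) \<longleftrightarrow> set (P (\<psi> u)) \<inter> set (P (\<psi> v)) \<noteq> {})"
    if u: "u \<in> pverts (G_of H)" and v: "v \<in> pverts (G_of H)" and uv: "u \<noteq> v" for u v
    using cases[OF u] cases[OF v]
  proof (elim disjE bexE exE conjE)
    fix a b assume "a \<in> pverts H" "u = Original a" "b \<in> pverts H" "v = Original b"
    then show ?thesis using OO[of a b] uv by (simp add: \<psi>_def H.G_of_Original_Original)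
  next
    fix a e assume "a \<in> pverts H" "u = Original a" "v = Edge e" "Edge e \<in> edge_vertices H"
    then show ?thesis using OE[of a e] by (simp add: \<psi>_def H.G_of_Original_Edge)
  next
    fix a e assume "a \<in> pverts H" "v = Original a" "u = Edge e" "Edge e \<in> edge_vertices H"
    then show ?thesis using OE[of a e] by (simp add: \<psi>_def H.G_of_Original_Edge Int_commute)
  next
    fix e e' assume "u = Edge e" "Edge e \<in> edge_vertices H" "v = Edge e'" "Edge e' \<in> edge_vertices H"
    then show ?thesis using EE[of e e'] uv by (auto simp: \<psi>_def H.G_of_Edge_Edge)
  qed
  have "embeds \<psi> (with_proj (G_of H)) G"
    unfolding embeds_def with_proj_simps
  proof (intro conjI ballI impI)
    show "inj_on \<psi> (pverts (G_of H))" using main by (meson inj_onI)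
    show "\<psi> ` pverts (G_of H) \<subseteq> verts G" using \<psi>_in by blast
    fix u v assume "u \<in> pverts (G_of H)" "v \<in> pverts (G_of H)" "u \<noteq> v"
    then show "(u, v) \<in> parcs (G_of H) \<longleftrightarrow> \<psi> u \<rightarrow>\<^bsub>G\<^esub> \<psi> v"
      using main adj[OF \<psi>_in \<psi>_in] by metis
  qed
  then show ?thesis using H by blast
qed

text \<open>\<open>H\<close> can be taken over \<open>nat\<close> because it is found among the
  neighbours of a node of the host tree.\<close>

theorem theorem19:
  fixes h :: nat and G :: "('a, 'b) pre_digraph"
  assumes "h \<ge> 3"
    and "graph G" and "connected G"
    and "VPT G"
  shows "minimal_non_h21 h G \<longleftrightarrow>
    (\<exists>H :: nat pair_pre_digraph.
       graph H \<and> connected H \<and> critical (h + 1) H \<and> digraph_iso G (G_of H))"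
proof
  assume min: "minimal_non_h21 h G"
  then have "\<not> in_h21 h G" by (simp add: minimal_non_h21_def)
  then obtain H :: "nat pair_pre_digraph" and \<psi> where H: "graph (with_proj H)"
    "connected (with_proj H)" "critical (Suc h) (with_proj H)"
    and emb: "embeds \<psi> (with_proj (G_of H)) G"
    using embeds_G_of_uncolourable assms by blast
  interpret H: crit_graph H h
    using H assms(1) by (intro crit_graph.intro) simp_all
  \<comment> \<open>If a vertex lay outside the copy of \<open>G_of H\<close>, deleting it would
    leave a graph of the class that still contains the copy; the class is hereditary and
    \<open>G_of H\<close> is not in it.\<close>
  have "verts G \<subseteq> \<psi> ` pverts (G_of H)"
  proof
    fix v assume v: "v \<in> verts G"
    show "v \<in> \<psi> ` pverts (G_of H)"
    proof (rule ccontr)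
      assume "v \<notin> \<psi> ` pverts (G_of H)"
      then have "embeds \<psi> (with_proj (G_of H)) (pre_digraph.del_vert G v)"
        using embeds_into_del_vert[OF emb] by simp
      then have "in_h21 h (with_proj (G_of H))"
        by (rule embeds_in_h21) (use min v in \<open>simp add: minimal_non_h21_def\<close>)
      then show False using H.G_of_not_in_h21 by blast
    qed
  qed
  then have "\<psi> ` pverts (G_of H) = verts G" using emb by (auto simp: embeds_def)
  then have "digraph_iso G (with_proj (G_of H))"
    by (rule bijective_embedding_digraph_iso[OF assms(2) emb _ H.G_of_arc_in])
  then show "\<exists>H :: nat pair_pre_digraph.
       graph H \<and> connected H \<and> critical (h + 1) H \<and> digraph_iso G (G_of H)"
    using H by auto
next
  assume "\<exists>H :: nat pair_pre_digraph.
       graph H \<and> connected H \<and> critical (h + 1) H \<and> digraph_iso G (G_of H)"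
  then obtain H :: "nat pair_pre_digraph" where H: "graph (with_proj H)"
    "critical (Suc h) (with_proj H)" "digraph_iso G (with_proj (G_of H))" by auto
  interpret H: crit_graph H h
    using H assms(1) by (intro crit_graph.intro) simp_all
  show "minimal_non_h21 h G"
    by (rule minimal_non_h21_iso[OF H(3) H.G_of_minimal_non_h21])
qed

end
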